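(* Let $G$, $W$, $\mathbb D$, $q=\dim_{\mathbb R}W$, $V=W\oplus W$, $E_{\mathbb D}$, $Z$ and $\mathcal P_4(G,W)$ be as in the context, and assume $\mathcal P_4(G,W)=0$. Let $x_1,\dots,x_s\in S(V)$, let $w_1,\dots,w_s>0$ with $\sum_i w_i=1$, and put $$\mu=\sum_{i=1}^s w_i\,\mu_{Gx_i},\qquad Z_i=Z(x_i).$$ Then the following are equivalent: (i) $\int f\,d\mu=\int_{S(V)}f\,d\sigma$ for every even real polynomial $f$ on $V$ of degree at most $4$; (ii) $\sum_i w_iZ_i=0$ and $\sum_i w_i\,Z_i\otimes Z_i=\frac{1}{2(q+1)}I_{E_{\mathbb D}}$. Consequently, whenever the equations in (ii) hold, the antipodalization $\mu^{\pm}$ is a weighted spherical $4$-design on $S(V)$. If moreover $\mu$ already has vanishing cubic moments (for example, if $\mu$ is antipodal, or if there are no nonzero $G$-invariant harmonic homogeneous cubic polynomials on $V$), then $\mu$ itself is a weighted spherical $4$-design.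
   Context: Let $G$ be a finite group and $W$ a nontrivial irreducible (finite-dimensional) real orthogonal $G$-module. Put $\mathbb D=\operatorname{End}_G(W)\in\{\mathbb R,\mathbb C,\mathbb H\}$ and regard $W$ as a right $\mathbb D$-module (in quaternionic type via $\operatorname{End}_G(W)^{\mathrm{op}}\simeq\mathbb H$). Put $d=\dim_{\mathbb R}\mathbb D\in\{1,2,4\}$, $n=\dim_{\mathbb D}W$, $q=\dim_{\mathbb R}W=dn$. Fix a $G$-invariant $\mathbb D$-Hermitian form $\langle\cdot,\cdot\rangle$ on $W$ (with $\langle xa,yb\rangle=\bar a\langle x,y\rangle b$) whose real part is the given real inner product. Let $V=W\oplus W$ with the diagonal $G$-action and the orthogonal direct sum inner product, $S(V)$ its unit sphere, $\sigma$ the normalized spherical measure on $S(V)$. For $x=(x_1,x_2)\in V$, the Hermitian Gram matrix is $H(x)=(\langle x_i,x_j\rangle)_{i,j}\in\operatorname{Herm}_2(\mathbb D)$, i.e. $H(x)=M_x^*M_x$ with $M_x=[x_1\ x_2]$. Let $E_{\mathbb D}$ be the real space of traceless matrices in $\operatorname{Herm}_2(\mathbb D)$ with inner product $\langle B,C\rangle_E=\operatorname{Re}\operatorname{tr}(BC)$. For $x\in S(V)$ the quadratic defect is $Z(x)=H(x)-\frac12I_2\in E_{\mathbb D}$; it is constant on $G$-orbits. The identity $\sum_i w_iZ_i\otimes Z_i=c\,I_{E_{\mathbb D}}$ means $\sum_i w_i\langle B,Z_i\rangle_E\langle C,Z_i\rangle_E=c\langle B,C\rangle_E$ for all $B,C\in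 E_{\mathbb D}$. For $B\in\operatorname{Herm}_2(\mathbb D)$ let $\gamma_B(x)=\operatorname{Re}\operatorname{tr}(BH(x))$, a real quadratic form on $V$. Let $\mathcal G_4(G,W)\subseteq\operatorname{Sym}^4(V^* )^G$ be the span of all products $\gamma_B\gamma_C$, $B,C\in\operatorname{Herm}_2(\mathbb D)$, inside the space of real $G$-invariant homogeneous quartics on $V$, and $\mathcal P_4(G,W)=\operatorname{Sym}^4(V^* )^G/\mathcal G_4(G,W)$. For a finite nonempty $X\subset S(V)$, $\mu_X=\frac1{|X|}\sum_{x\in X}\delta_x$. A weighted spherical $t$-design on $S(V)$ is a finitely supported probability measure $\mu$ on $S(V)$ with $\int f\,d\mu=\int f\,d\sigma$ for all real polynomials $f$ of degree at most $t$. The antipodalization of $\mu$ is $\mu^{\pm}=\frac12(\mu+(-I)_*\mu)$; $\mu$ is antipodal if $(-I)_*\mu=\mu$. Vanishing cubic moments means that $\int f\,d\mu=0$ for every homogeneous cubic polynomial $f$. *)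

theory Defs
  imports "HOL-Probability.Probability" "HOL-Algebra.Group_Action"
begin

datatype quat = Quat (qRe: real) (qI: real) (qJ: real) (qK: real)

lemma quat_eq_iff: "a = b \<longleftrightarrow> qRe a = qRe b \<and> qI a = qI b \<and> qJ a = qJ b \<and> qK a = qK b"
  by (cases a; cases b) auto

instantiation quat :: real_algebra_1
begin

definition zero_quat :: quat where "0 = Quat 0 0 0 0"
definition one_quat :: quat where "1 = Quat 1 0 0 0"
definition plus_quat :: "quat \<Rightarrow> quat \<Rightarrow> quat" where
  "a + b = Quat (qRe a + qRe b) (qI a + qI b) (qJ a + qJ b) (qK a + qK b)"
definition minus_quat :: "quat \<Rightarrow> quat \<Rightarrow> quat" where
  "a - b = Quat (qRe a - qRe b) (qI a - qI b) (qJ a - qJ b) (qK a - qK b)"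
definition uminus_quat :: "quat \<Rightarrow> quat" where
  "- a = Quat (- qRe a) (- qI a) (- qJ a) (- qK a)"
definition scaleR_quat :: "real \<Rightarrow> quat \<Rightarrow> quat" where
  "r *\<^sub>R a = Quat (r * qRe a) (r * qI a) (r * qJ a) (r * qK a)"
definition times_quat :: "quat \<Rightarrow> quat \<Rightarrow> quat" where
  "a * b = Quat
     (qRe a * qRe b - qI a * qI b - qJ a * qJ b - qK a * qK b)
     (qRe a * qI b + qI a * qRe b + qJ a * qK b - qK a * qJ b)
     (qRe a * qJ b - qI a * qK b + qJ a * qRe b + qK a * qI b)
     (qRe a * qK b + qI a * qJ b - qJ a * qI b + qK a * qRe b)"

instance
  by intro_classes
    (auto simp: zero_quat_def one_quat_def plus_quat_def minus_quat_def uminus_quat_def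
       scaleR_quat_def times_quat_def algebra_simps)

end

definition qcnj :: "quat \<Rightarrow> quat" where
  "qcnj a = Quat (qRe a) (- qI a) (- qJ a) (- qK a)"

text \<open>The real numbers and the complex numbers are used as the subalgebras \<open>\<real>\<close> (= the range of
  \<^term>\<open>of_real\<close>) and \<open>quat_complexes\<close> of the quaternions.\<close>

definition quat_complexes :: "quat set" where
  "quat_complexes = {a. qJ a = 0 \<and> qK a = 0}"

text \<open>A Euclidean space type is finite-dimensional and nonzero.\<close>

definition orthogonal_module ::
    "('g, 'r) monoid_scheme \<Rightarrow> ('g \<Rightarrow> 'a::euclidean_space \<Rightarrow> 'a) \<Rightarrow> bool" where
  "orthogonal_module G \<rho> \<longleftrightarrow>
     group_action G UNIV \<rho> \<and> (\<forall>g\<in>carrier G. orthogonal_transformation (\<rho> g))"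

definition irreducible_module ::
    "('g, 'r) monoid_scheme \<Rightarrow> ('g \<Rightarrow> 'a::euclidean_space \<Rightarrow> 'a) \<Rightarrow> bool" where
  "irreducible_module G \<rho> \<longleftrightarrow>
     (\<forall>U. subspace U \<and> (\<forall>g\<in>carrier G. \<rho> g ` U \<subseteq> U) \<longrightarrow> U = {0} \<or> U = UNIV)"

definition nontrivial_module ::
    "('g, 'r) monoid_scheme \<Rightarrow> ('g \<Rightarrow> 'a::euclidean_space \<Rightarrow> 'a) \<Rightarrow> bool" where
  "nontrivial_module G \<rho> \<longleftrightarrow> (\<exists>g\<in>carrier G. \<exists>x. \<rho> g x \<noteq> x)"

definition equivariant_endos ::
    "('g, 'r) monoid_scheme \<Rightarrow> ('g \<Rightarrow> 'a::euclidean_space \<Rightarrow> 'a) \<Rightarrow> ('a \<Rightarrow> 'a) set" where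
  "equivariant_endos G \<rho> = {f. linear f \<and> (\<forall>g\<in>carrier G. \<forall>x. f (\<rho> g x) = \<rho> g (f x))}"

text \<open>\<open>act x a\<close> is the right multiplication of \<open>x\<close> by \<open>a\<close>. The conditions say that
  \<open>a \<mapsto> (\<lambda>x. act x a)\<close> is an isomorphism of real algebras from \<open>D\<close>, one of the reals, the complex
  numbers, the quaternions, onto the opposite algebra of the equivariant endomorphisms;
  in the first two cases this algebra is commutative and the opposite is immaterial.\<close>

definition endo_scalars ::
    "('g, 'r) monoid_scheme \<Rightarrow> ('g \<Rightarrow> 'a::euclidean_space \<Rightarrow> 'a) \<Rightarrow> quat set \<Rightarrow> ('a \<Rightarrow> quat \<Rightarrow> 'a) \<Rightarrow> bool" where
  "endo_scalars G \<rho> D act \<longleftrightarrow>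
     D \<in> {\<real>, quat_complexes, UNIV} \<and>
     bij_betw (\<lambda>a x. act x a) D (equivariant_endos G \<rho>) \<and>
     (\<forall>x. act x 1 = x) \<and>
     (\<forall>x. \<forall>a\<in>D. \<forall>b\<in>D. act x (a * b) = act (act x a) b) \<and>
     (\<forall>x. \<forall>a\<in>D. \<forall>b\<in>D. act x (a + b) = act x a + act x b) \<and>
     (\<forall>x r. \<forall>a\<in>D. act x (r *\<^sub>R a) = r *\<^sub>R act x a)"

definition invariant_hermitian_form ::
    "('g, 'r) monoid_scheme \<Rightarrow> ('g \<Rightarrow> 'a::euclidean_space \<Rightarrow> 'a) \<Rightarrow> quat set \<Rightarrow> ('a \<Rightarrow> quat \<Rightarrow> 'a)
       \<Rightarrow> ('a \<Rightarrow> 'a \<Rightarrow> quat) \<Rightarrow> bool" where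
  "invariant_hermitian_form G \<rho> D act h \<longleftrightarrow>
     (\<forall>x y. h x y \<in> D) \<and>
     (\<forall>x y z. h (x + y) z = h x z + h y z) \<and>
     (\<forall>x y z. h x (y + z) = h x y + h x z) \<and>
     (\<forall>x y. \<forall>a\<in>D. \<forall>b\<in>D. h (act x a) (act y b) = qcnj a * h x y * b) \<and>
     (\<forall>x y. h y x = qcnj (h x y)) \<and>
     (\<forall>g\<in>carrier G. \<forall>x y. h (\<rho> g x) (\<rho> g y) = h x y) \<and>
     (\<forall>x y. qRe (h x y) = x \<bullet> y)"

text \<open>The module \<open>W \<oplus> W\<close> is the type \<open>'a ^ 2\<close>, whose inner product is the orthogonal sum.\<close>

definition diag_action :: "('g \<Rightarrow> 'a \<Rightarrow> 'a) \<Rightarrow> 'g \<Rightarrow> 'a ^ 2 \<Rightarrow> 'a ^ 2" where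
  "diag_action \<rho> g x = (\<chi> i. \<rho> g (x $ i))"

definition Herm2 :: "quat set \<Rightarrow> (quat ^ 2 ^ 2) set" where
  "Herm2 D = {B. (\<forall>i j. B $ i $ j \<in> D) \<and> (\<forall>i j. B $ j $ i = qcnj (B $ i $ j))}"

definition traceless_Herm2 :: "quat set \<Rightarrow> (quat ^ 2 ^ 2) set" where
  "traceless_Herm2 D = {B \<in> Herm2 D. trace B = 0}"

definition re_trace_form :: "quat ^ 2 ^ 2 \<Rightarrow> quat ^ 2 ^ 2 \<Rightarrow> real" where
  "re_trace_form B C = qRe (trace (B ** C))"

definition gram_matrix :: "('a \<Rightarrow> 'a \<Rightarrow> quat) \<Rightarrow> 'a ^ 2 \<Rightarrow> quat ^ 2 ^ 2" where
  "gram_matrix h x = (\<chi> i j. h (x $ i) (x $ j))"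

definition quadratic_defect :: "('a \<Rightarrow> 'a \<Rightarrow> quat) \<Rightarrow> 'a ^ 2 \<Rightarrow> quat ^ 2 ^ 2" where
  "quadratic_defect h x = gram_matrix h x - (1/2) *\<^sub>R mat 1"

definition gram_quadratic :: "('a \<Rightarrow> 'a \<Rightarrow> quat) \<Rightarrow> quat ^ 2 ^ 2 \<Rightarrow> 'a ^ 2 \<Rightarrow> real" where
  "gram_quadratic h B x = re_trace_form B (gram_matrix h x)"

definition defect_equations ::
    "quat set \<Rightarrow> ('a::euclidean_space \<Rightarrow> 'a \<Rightarrow> quat) \<Rightarrow> nat \<Rightarrow> (nat \<Rightarrow> real) \<Rightarrow> (nat \<Rightarrow> 'a ^ 2) \<Rightarrow> bool" where
  "defect_equations D h s w x \<longleftrightarrow>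
     (\<Sum>i<s. w i *\<^sub>R quadratic_defect h (x i)) = 0 \<and>
     (\<forall>B\<in>traceless_Herm2 D. \<forall>C\<in>traceless_Herm2 D.
        (\<Sum>i<s. w i * re_trace_form B (quadratic_defect h (x i))
                    * re_trace_form C (quadratic_defect h (x i)))
        = 1 / (2 * (real DIM('a) + 1)) * re_trace_form B C)"

definition homogeneous_poly :: "nat \<Rightarrow> ('v::euclidean_space \<Rightarrow> real) \<Rightarrow> bool" where
  "homogeneous_poly k f \<longleftrightarrow> real_polynomial_function f \<and> (\<forall>c x. f (c *\<^sub>R x) = c ^ k * f x)"

definition poly_degree_le :: "nat \<Rightarrow> ('v::euclidean_space \<Rightarrow> real) \<Rightarrow> bool" where
  "poly_degree_le t f \<longleftrightarrow>
     (\<exists>p. (\<forall>k\<le>t. homogeneous_poly k (p k)) \<and> (\<forall>x. f x = (\<Sum>k\<le>t. p k x)))"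

definition invariant_fun ::
    "('g, 'r) monoid_scheme \<Rightarrow> ('g \<Rightarrow> 'a \<Rightarrow> 'a) \<Rightarrow> ('a ^ 2 \<Rightarrow> real) \<Rightarrow> bool" where
  "invariant_fun G \<rho> f \<longleftrightarrow> (\<forall>g\<in>carrier G. \<forall>x. f (diag_action \<rho> g x) = f x)"

definition laplacian :: "('v::euclidean_space \<Rightarrow> real) \<Rightarrow> 'v \<Rightarrow> real" where
  "laplacian f x = (\<Sum>b\<in>Basis. (deriv ^^ 2) (\<lambda>t. f (x + t *\<^sub>R b)) 0)"

definition harmonic_fun :: "('v::euclidean_space \<Rightarrow> real) \<Rightarrow> bool" where
  "harmonic_fun f \<longleftrightarrow> (\<forall>x. laplacian f x = 0)"

definition invariant_quartics ::
    "('g, 'r) monoid_scheme \<Rightarrow> ('g \<Rightarrow> 'a::euclidean_space \<Rightarrow> 'a) \<Rightarrow> ('a ^ 2 \<Rightarrow> real) set" where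
  "invariant_quartics G \<rho> = {f. homogeneous_poly 4 f \<and> invariant_fun G \<rho> f}"

definition gram_quartics :: "quat set \<Rightarrow> ('a \<Rightarrow> 'a \<Rightarrow> quat) \<Rightarrow> ('a ^ 2 \<Rightarrow> real) set" where
  "gram_quartics D h =
     {f. \<exists>(m::nat) c B C. (\<forall>k<m. B k \<in> Herm2 D \<and> C k \<in> Herm2 D) \<and>
           f = (\<lambda>x. \<Sum>k<m. c k * (gram_quadratic h (B k) x * gram_quadratic h (C k) x))}"

text \<open>The quotient space, as the set of cosets; it vanishes iff its only element is the zero coset
  \<^term>\<open>gram_quartics D h\<close>.\<close>

definition quartic_quotient ::
    "('g, 'r) monoid_scheme \<Rightarrow> ('g \<Rightarrow> 'a::euclidean_space \<Rightarrow> 'a) \<Rightarrow> quat set \<Rightarrow> ('a \<Rightarrow> 'a \<Rightarrow> quat)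
       \<Rightarrow> ('a ^ 2 \<Rightarrow> real) set set" where
  "quartic_quotient G \<rho> D h =
     invariant_quartics G \<rho> //
       {(f, f'). f \<in> invariant_quartics G \<rho> \<and> f' \<in> invariant_quartics G \<rho> \<and>
                 (\<lambda>x. f x - f' x) \<in> gram_quartics D h}"

text \<open>The normalized spherical measure, as a measure on the ambient space: the radial projection
  of the uniform distribution on the unit ball (the set of measure zero where \<^term>\<open>sgn\<close> vanishes
  does not matter).\<close>

definition spherical_measure :: "'v::euclidean_space measure" where
  "spherical_measure = distr (uniform_measure lborel (cball 0 1)) borel sgn"

text \<open>Finitely supported probability measures are represented as \<open>pmf\<close>s with finite support.\<close>

definition orbit_mixture ::
    "('g, 'r) monoid_scheme \<Rightarrow> ('g \<Rightarrow> 'a \<Rightarrow> 'a) \<Rightarrow> nat \<Rightarrow> (nat \<Rightarrow> real) \<Rightarrow> (nat \<Rightarrow> 'a ^ 2) \<Rightarrow> ('a ^ 2) pmf" where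
  "orbit_mixture G \<rho> s w x =
     embed_pmf (\<lambda>y. \<Sum>i<s. w i * pmf (pmf_of_set (orbit G (diag_action \<rho>) (x i))) y)"

lemma pmf_orbit_mixture:
  assumes "\<And>i. i < s \<Longrightarrow> w i > 0" and "(\<Sum>i<s. w i) = 1"
  shows "pmf (orbit_mixture G \<rho> s w x) y =
    (\<Sum>i<s. w i * pmf (pmf_of_set (orbit G (diag_action \<rho>) (x i))) y)"
  unfolding orbit_mixture_def
proof (rule pmf_embed_pmf)
  show "0 \<le> (\<Sum>i<s. w i * pmf (pmf_of_set (orbit G (diag_action \<rho>) (x i))) y)" for y
    using assms(1) by (intro sum_nonneg) (simp add: less_imp_le)
  have "(\<integral>\<^sup>+y. ennreal (\<Sum>i<s. w i * pmf (pmf_of_set (orbit G (diag_action \<rho>) (x i))) y) \<partial>count_space UNIV)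
      = (\<integral>\<^sup>+y. (\<Sum>i<s. ennreal (w i) * ennreal (pmf (pmf_of_set (orbit G (diag_action \<rho>) (x i))) y)) \<partial>count_space UNIV)"
  proof (rule nn_integral_cong)
    fix y
    show "ennreal (\<Sum>i<s. w i * pmf (pmf_of_set (orbit G (diag_action \<rho>) (x i))) y)
        = (\<Sum>i<s. ennreal (w i) * ennreal (pmf (pmf_of_set (orbit G (diag_action \<rho>) (x i))) y))"
      using assms(1) by (subst sum_ennreal[symmetric])
        (auto simp: less_imp_le ennreal_mult intro!: mult_nonneg_nonneg)
  qed
  also have "\<dots> = (\<Sum>i<s. ennreal (w i))"
    by (simp add: nn_integral_sum nn_integral_cmult nn_integral_pmf measure_pmf.emeasure_space_1[simplified])
  also have "\<dots> = 1"
    using assms by (subst sum_ennreal) (auto simp: less_imp_le)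
  finally show "(\<integral>\<^sup>+y. ennreal (\<Sum>i<s. w i * pmf (pmf_of_set (orbit G (diag_action \<rho>) (x i))) y) \<partial>count_space UNIV) = 1" .
qed

definition antipodalization :: "'v::real_vector pmf \<Rightarrow> 'v pmf" where
  "antipodalization \<mu> = embed_pmf (\<lambda>y. (pmf \<mu> y + pmf (map_pmf uminus \<mu>) y) / 2)"

lemma pmf_antipodalization:
  "pmf (antipodalization \<mu>) y = (pmf \<mu> y + pmf (map_pmf uminus \<mu>) y) / 2"
  unfolding antipodalization_def
proof (rule pmf_embed_pmf)
  have "(\<integral>\<^sup>+y. ennreal ((pmf \<mu> y + pmf (map_pmf uminus \<mu>) y) / 2) \<partial>count_space UNIV)
      = (\<integral>\<^sup>+y. ennreal (1/2) * (ennreal (pmf \<mu> y) + ennreal (pmf (map_pmf uminus \<mu>) y)) \<partial>count_space UNIV)"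
  proof (rule nn_integral_cong)
    fix y
    have "(pmf \<mu> y + pmf (map_pmf uminus \<mu>) y) / 2 = (1/2) * (pmf \<mu> y + pmf (map_pmf uminus \<mu>) y)"
      by simp
    then show "ennreal ((pmf \<mu> y + pmf (map_pmf uminus \<mu>) y) / 2)
        = ennreal (1/2) * (ennreal (pmf \<mu> y) + ennreal (pmf (map_pmf uminus \<mu>) y))"
      by (metis ennreal_mult ennreal_plus pmf_nonneg add_nonneg_nonneg zero_le_divide_1_iff zero_le_numeral)
  qed
  also have "\<dots> = ennreal (1/2) * (1 + 1)"
    by (simp add: nn_integral_cmult nn_integral_add nn_integral_pmf
        measure_pmf.emeasure_space_1[simplified] del: ennreal_half)
  also have "\<dots> = 1"
  proof -
    have "ennreal (1/2) * (1 + 1) = ennreal (1/2) * ennreal 2"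
      by simp
    also have "\<dots> = ennreal (1/2 * 2)"
      by (rule ennreal_mult[symmetric]) simp_all
    finally show ?thesis by simp
  qed
  finally show "(\<integral>\<^sup>+y. ennreal ((pmf \<mu> y + pmf (map_pmf uminus \<mu>) y) / 2) \<partial>count_space UNIV) = 1" .
qed simp

definition antipodal :: "'v::real_vector pmf \<Rightarrow> bool" where
  "antipodal \<mu> \<longleftrightarrow> map_pmf uminus \<mu> = \<mu>"

definition weighted_spherical_design :: "nat \<Rightarrow> 'v::euclidean_space pmf \<Rightarrow> bool" where
  "weighted_spherical_design t \<mu> \<longleftrightarrow>
     finite (set_pmf \<mu>) \<and> set_pmf \<mu> \<subseteq> sphere 0 1 \<and>
     (\<forall>f. poly_degree_le t f \<longrightarrow> measure_pmf.expectation \<mu> f = (\<integral>x. f x \<partial>spherical_measure))"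

definition vanishing_cubic_moments :: "'v::euclidean_space pmf \<Rightarrow> bool" where
  "vanishing_cubic_moments \<mu> \<longleftrightarrow>
     (\<forall>f. homogeneous_poly 3 f \<longrightarrow> measure_pmf.expectation \<mu> f = 0)"

end

theory Submission
  imports Defs
begin

text \<open>The averages of \<open>f\<close> over an orbit mixture and over the sphere do not change when \<open>f\<close> is
  replaced by its average over \<open>G\<close>. On the sphere an even polynomial of degree at most 4 agrees with a
  homogeneous quartic, whose group average lies, by the hypothesis on the quartic quotient, in the
  span of the products \<open>\<gamma>\<^sub>B \<gamma>\<^sub>C\<close>. So (i) only has to be tested on these products. Rotation
  invariance and polarization give the fourth moments of the sphere, and writing
  \<open>\<gamma>\<^sub>B x = x \<bullet> A\<^sub>B x\<close> with \<open>A\<^sub>B\<close> self-adjoint, \<open>tr A\<^sub>B = q tr B\<close> and \<open>tr (A\<^sub>B A\<^sub>C) = q \<langle>B, C\<rangle>\<close>,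
  they turn the test into the two defect equations. For the cubic moments, the Laplacian of an
  invariant cubic is an invariant linear form on \<open>W \<oplus> W\<close>, hence zero: every invariant cubic is
  harmonic.\<close>

section \<open>The spherical measure\<close>

text \<open>The only properties extracted from the sphere measure are its invariance under
  orthogonal maps and its total mass one on the unit sphere. Invariance determines the fourth
  moments up to one constant, and |x|^4 = 1 fixes that constant.

  With q = dim W the space V has dimension 2q, so for traceless B and C the moment of the product of
  their Gram forms is 2q<B,C> / (2q(2q+2)) = <B,C> / (2(q+1)): this is the constant in (ii). The
  identity matrix gives the form |x|^2, which is 1 on the sphere, so every Gram form restricts there
  to a traceless one plus a constant. In a product of two of them the cross terms are governed by
  the first equation and the traceless product by the second. Conversely, the matrix equation for
  the mean of the Z_i follows from scalar test functions because the trace form is positive definite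
  on Hermitian matrices.

  The three types of D are treated at once inside the quaternions. Noncommutativity is met by taking
  real parts, Re(ab) = Re(ba), and by h(u,u) being real, hence central.\<close>

text \<open>Both measures are translation invariant, so by Fubini their product with a ball \<open>B\<close> can be
  computed in two ways; they agree because \<open>g\<close> preserves balls.\<close>

lemma distr_lborel_orthogonal:
  fixes g :: "'v::euclidean_space \<Rightarrow> 'v"
  assumes g: "orthogonal_transformation g"
  shows "distr lborel borel g = lborel"
proof (rule measure_eqI)
  fix A :: "'v set"
  assume "A \<in> sets (distr lborel borel g)"
  then have A [measurable]: "A \<in> sets borel" by simp
  have [measurable]: "g \<in> borel_measurable borel"
    using g by (simp add: borel_measurable_continuous_onI linear_continuous_on
        linear_conv_bounded_linear[symmetric] orthogonal_transformation_linear)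
  define B :: "'v set" where "B = ball 0 1"
  have [measurable]: "B \<in> sets borel" by (simp add: B_def)
  define I where "I = (\<integral>\<^sup>+z. \<integral>\<^sup>+y. indicator A y * indicator B (y - g z) \<partial>lborel \<partial>lborel)"
  have "I = (\<integral>\<^sup>+z. \<integral>\<^sup>+y. indicator A (g z + y) * indicator B y \<partial>lborel \<partial>lborel)"
    unfolding I_def
  proof (rule nn_integral_cong)
    fix z
    have "(\<integral>\<^sup>+y. indicator A y * indicator B (y - g z) \<partial>lborel)
        = (\<integral>\<^sup>+y. indicator A y * indicator B (y - g z) \<partial>distr lborel borel ((+) (g z)) :: ennreal)"
      by (simp add: lborel_distr_plus)
    then show "(\<integral>\<^sup>+y. indicator A y * indicator B (y - g z) \<partial>lborel)
        = (\<integral>\<^sup>+y. indicator A (g z + y) * indicator B y \<partial>lborel :: ennreal)"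
      by (subst (asm) nn_integral_distr) auto
  qed
  also have "\<dots> = (\<integral>\<^sup>+y. \<integral>\<^sup>+z. indicator A (g z + y) * indicator B y \<partial>lborel \<partial>lborel)"
    by (rule lborel_pair.Fubini') measurable
  also have "\<dots> = (\<integral>\<^sup>+y. emeasure (distr lborel borel g) A * indicator B y \<partial>lborel)"
  proof (rule nn_integral_cong)
    fix y
    obtain u where u: "g u = y"
      using orthogonal_transformation_surj[OF g] by (metis surjD)
    have lin: "g (u + z) = g z + y" for z
      using u g by (simp add: orthogonal_transformation_def linear_add)
    have "(\<integral>\<^sup>+z. indicator A (g z) \<partial>lborel)
        = (\<integral>\<^sup>+z. indicator A (g z) \<partial>distr lborel borel ((+) u) :: ennreal)"
      by (simp add: lborel_distr_plus)
    also have "\<dots> = (\<integral>\<^sup>+z. indicator A (g z + y) \<partial>lborel)"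
      by (subst nn_integral_distr) (auto simp: lin)
    finally have "emeasure (distr lborel borel g) A = (\<integral>\<^sup>+z. indicator A (g z + y) \<partial>lborel)"
      by (simp add: nn_integral_distr flip: nn_integral_indicator)
    then show "(\<integral>\<^sup>+z. indicator A (g z + y) * indicator B y \<partial>lborel)
        = emeasure (distr lborel borel g) A * indicator B y"
      by (simp add: nn_integral_multc)
  qed
  also have "\<dots> = emeasure (distr lborel borel g) A * emeasure lborel B"
    by (simp add: nn_integral_cmult)
  finally have 1: "I = emeasure (distr lborel borel g) A * emeasure lborel B" .
  have "I = (\<integral>\<^sup>+y. \<integral>\<^sup>+z. indicator A y * indicator B (y - g z) \<partial>lborel \<partial>lborel)"
    unfolding I_def by (rule lborel_pair.Fubini') measurable
  also have "\<dots> = (\<integral>\<^sup>+y. indicator A y * emeasure lborel B \<partial>lborel)"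
  proof (rule nn_integral_cong)
    fix y
    obtain u where u: "g u = y"
      using orthogonal_transformation_surj[OF g] by (metis surjD)
    have "norm (y - g z) = norm (u - z)" for z
      using u g orthogonal_transformation_norm[OF g, of "u - z"]
      by (simp add: orthogonal_transformation_def linear_diff)
    then have "indicator B (y - g z) = (indicator (ball u 1) z :: ennreal)" for z
      by (simp add: B_def indicator_def dist_norm norm_minus_commute)
    then show "(\<integral>\<^sup>+z. indicator A y * indicator B (y - g z) \<partial>lborel)
        = indicator A y * emeasure lborel B"
      by (simp add: nn_integral_cmult_indicator B_def emeasure_ball)
  qed
  also have "\<dots> = emeasure lborel A * emeasure lborel B"
    by (simp add: nn_integral_multc)
  finally have 2: "I = emeasure lborel A * emeasure lborel B" .
  have "emeasure lborel B \<noteq> 0" "emeasure lborel B \<noteq> \<top>"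
    by (auto simp: B_def emeasure_ball unit_ball_vol_pos less_imp_neq[symmetric])
  with 1 2 show "emeasure (distr lborel borel g) A = emeasure lborel A"
    by (metis ennreal_mult_divide_eq)
qed simp

lemma prob_space_uniform_cball: "prob_space (uniform_measure lborel (cball (0::'v::euclidean_space) 1))"
  by (rule prob_space_uniform_measure)
    (auto simp: emeasure_cball unit_ball_vol_pos less_imp_neq[symmetric])

lemma borel_measurable_sgn' [measurable]:
  "(sgn :: 'v::euclidean_space \<Rightarrow> 'v) \<in> borel_measurable borel"
  unfolding sgn_div_norm by measurable

lemma sets_spherical_measure [simp, measurable_cong]: "sets spherical_measure = sets borel"
  and space_spherical_measure [simp]: "space spherical_measure = UNIV"
  by (simp_all add: spherical_measure_def)

lemma prob_space_spherical_measure: "prob_space spherical_measure"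
  unfolding spherical_measure_def
  by (intro prob_space.prob_space_distr prob_space_uniform_cball) measurable

lemma AE_spherical_measure: "AE x in (spherical_measure :: 'v::euclidean_space measure). norm x = 1"
proof -
  have "AE x in lborel. x \<noteq> (0::'v)"
    by (rule AE_lborel_singleton)
  then have "AE x in uniform_measure lborel (cball (0::'v) 1). norm (sgn x) = 1"
    by (intro AE_uniform_measureI) (auto simp: norm_sgn elim!: eventually_mono)
  then show ?thesis
    unfolding spherical_measure_def by (subst AE_distr_iff) auto
qed

text \<open>A linear isometry preserves the unit ball and commutes with \<open>sgn\<close>, so the
  invariance of Lebesgue measure survives both conditioning on the ball and radial
  projection.\<close>

lemma distr_spherical_orthogonal:
  fixes g :: "'v::euclidean_space \<Rightarrow> 'v"
  assumes g: "orthogonal_transformation g"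
  shows "distr spherical_measure borel g = spherical_measure"
proof -
  have lin: "linear g" and n: "\<And>x. norm (g x) = norm x"
    using g orthogonal_transformation_linear orthogonal_transformation_norm by auto
  have [measurable]: "g \<in> borel_measurable borel"
    using lin by (simp add: borel_measurable_continuous_onI linear_continuous_on
        linear_conv_bounded_linear[symmetric])
  have sg: "g (sgn x) = sgn (g x)" for x
    using lin n by (simp add: sgn_div_norm linear_cmul)
  let ?U = "uniform_measure lborel (cball (0::'v) 1)"
  have U: "distr ?U borel g = ?U"
  proof (rule measure_eqI)
    fix A :: "'v set" assume "A \<in> sets (distr ?U borel g)"
    then have [measurable]: "A \<in> sets borel" by simp
    have [measurable]: "g -` A \<in> sets borel"
      using measurable_sets[of g borel borel A] by simp
    have "cball 0 1 \<inter> g -` A = g -` (cball 0 1 \<inter> A)" by (auto simp: n)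
    then have "emeasure lborel (cball 0 1 \<inter> g -` A) = emeasure (distr lborel borel g) (cball 0 1 \<inter> A)"
      by (simp add: emeasure_distr)
    also have "\<dots> = emeasure lborel (cball 0 1 \<inter> A)"
      by (simp add: distr_lborel_orthogonal[OF g])
    finally show "emeasure (distr ?U borel g) A = emeasure ?U A"
      by (simp add: emeasure_distr)
  qed simp
  have "distr spherical_measure borel g = distr ?U borel (g \<circ> sgn)"
    unfolding spherical_measure_def by (subst distr_distr) auto
  also have "g \<circ> sgn = sgn \<circ> g" by (auto simp: sg)
  also have "distr ?U borel (sgn \<circ> g) = distr (distr ?U borel g) borel sgn"
    by (subst distr_distr) auto
  finally show ?thesis
    by (simp add: U spherical_measure_def)
qed

lemma integral_spherical_orthogonal:
  fixes g :: "'v::euclidean_space \<Rightarrow> 'v" and f :: "'v \<Rightarrow> real"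
  assumes g: "orthogonal_transformation g" and f: "continuous_on UNIV f"
  shows "(\<integral>x. f (g x) \<partial>spherical_measure) = (\<integral>x. f x \<partial>spherical_measure)"
proof -
  have [measurable]: "f \<in> borel_measurable borel" "g \<in> borel_measurable borel"
    using f g by (auto simp: borel_measurable_continuous_onI linear_continuous_on
        linear_conv_bounded_linear[symmetric] orthogonal_transformation_linear)
  have "(\<integral>x. f (g x) \<partial>spherical_measure) = (\<integral>x. f x \<partial>distr spherical_measure borel g)"
    by (subst integral_distr) auto
  then show ?thesis by (simp add: distr_spherical_orthogonal[OF g])
qed

text \<open>The measure lives on the ambient space, where a continuous function may be unbounded; it
  is concentrated on the compact sphere, where the function is bounded.\<close>

lemma integrable_spherical_continuous:
  fixes f :: "'v::euclidean_space \<Rightarrow> real"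
  assumes f: "continuous_on UNIV f"
  shows "integrable spherical_measure f"
proof -
  interpret prob_space "spherical_measure :: 'v measure" by (rule prob_space_spherical_measure)
  have "bounded (f ` sphere 0 1)"
    using f by (intro compact_imp_bounded compact_continuous_image) (auto intro: continuous_on_subset)
  then obtain B where B: "\<And>x. norm x = 1 \<Longrightarrow> norm (f x) \<le> B"
    unfolding bounded_iff by fastforce
  have [measurable]: "f \<in> borel_measurable borel"
    using f by (rule borel_measurable_continuous_onI)
  show ?thesis
    by (rule integrable_const_bound[where B = B])
      (use AE_spherical_measure B in \<open>auto elim!: eventually_mono\<close>)
qed

text \<open>Used to insert or remove, under the integral, factors that equal 1 on the
  sphere.\<close>

lemma integral_spherical_cong:
  fixes f f' :: "'v::euclidean_space \<Rightarrow> real"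
  assumes "continuous_on UNIV f" "continuous_on UNIV f'" "\<And>x. norm x = 1 \<Longrightarrow> f x = f' x"
  shows "(\<integral>x. f x \<partial>spherical_measure) = (\<integral>x. f' x \<partial>spherical_measure)"
proof (rule integral_cong_AE)
  show "AE x in spherical_measure. f x = f' x"
    using AE_spherical_measure by (rule eventually_mono) (rule assms(3))
qed (use assms in \<open>auto intro: borel_measurable_continuous_onI simp: measurable_cong_sets[OF sets_spherical_measure refl]\<close>)

section \<open>Fourth moments of the sphere\<close>

text \<open>The reflection in the hyperplane orthogonal to \<open>a - b\<close> exchanges two
  vectors of equal norm. It supplies the transitivity of the orthogonal group on spheres.\<close>

lemma orthogonal_transformation_reflect:
  fixes a b :: "'v::euclidean_space"
  assumes "norm a = norm b"
  obtains g where "orthogonal_transformation g" "g a = b"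
proof (cases "a = b")
  case True
  then show ?thesis
    using that[of "\<lambda>x. x"] by simp
next
  case False
  define v where "v = a - b"
  define g where "g x = x - (2 * (x \<bullet> v) / (v \<bullet> v)) *\<^sub>R v" for x
  have v: "v \<bullet> v \<noteq> 0" using False by (simp add: v_def)
  have "linear g"
    by (rule linearI) (simp_all add: g_def algebra_simps inner_add_left add_divide_distrib)
  moreover have "g x \<bullet> g y = x \<bullet> y" for x y
    using v by (simp add: g_def inner_diff_left inner_diff_right inner_commute field_simps)
  ultimately have "orthogonal_transformation g"
    by (simp add: orthogonal_transformation_def)
  moreover have "a \<bullet> a = b \<bullet> b"
    using assms by (simp add: norm_eq)
  \<comment> \<open>Equality of the norms makes the coefficient in \<open>g a\<close> equal to 1, so
    that \<open>g a = a - v = b\<close>.\<close>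
  then have "2 * (a \<bullet> v) = v \<bullet> v"
    by (simp add: v_def inner_diff_left inner_diff_right inner_commute)
  then have "g a = b"
    using v by (simp add: g_def v_def)
  ultimately show ?thesis by (rule that)
qed

text \<open>Some orthogonal map takes a multiple of a fixed unit vector to \<open>a\<close>, so by
  invariance the moment depends on \<open>a\<close> only through its norm. The value of
  \<open>K\<close> is left open here.\<close>

lemma spherical_moment_4_power:
  obtains K where "\<And>a::'v::euclidean_space. (\<integral>x. (x \<bullet> a) ^ 4 \<partial>spherical_measure) = K * norm a ^ 4"
proof -
  let ?I = "\<lambda>a::'v. \<integral>x. (x \<bullet> a) ^ 4 \<partial>spherical_measure"
  obtain e :: 'v where e: "e \<in> Basis" using nonempty_Basis by blast
  have "?I a = ?I e * norm a ^ 4" for a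
  proof -
    have "norm (norm a *\<^sub>R e) = norm a" using e by simp
    then obtain g where g: "orthogonal_transformation g" "g (norm a *\<^sub>R e) = a"
      by (rule orthogonal_transformation_reflect)
    have "?I a = (\<integral>x. (g x \<bullet> a) ^ 4 \<partial>spherical_measure)"
      by (rule integral_spherical_orthogonal[OF g(1), symmetric]) (intro continuous_intros)
    also have "(\<lambda>x. (g x \<bullet> a) ^ 4) = (\<lambda>x. norm a ^ 4 * (x \<bullet> e) ^ 4)"
    proof
      fix x
      have "g x \<bullet> a = x \<bullet> (norm a *\<^sub>R e)"
        using g by (metis orthogonal_transformation_def)
      then show "(g x \<bullet> a) ^ 4 = norm a ^ 4 * (x \<bullet> e) ^ 4"
        by (simp add: power_mult_distrib)
    qed
    finally show ?thesis by simp
  qed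
  then show ?thesis by (rule that)
qed

text \<open>Pure powers determine all fourth moments by polarization: first two squares, then one
  square, then four arbitrary vectors. Each of the three pairings carries the weight
  \<open>K / 3\<close>, since they coincide when all four vectors are equal.\<close>

lemma spherical_moment_4:
  fixes a b c d :: "'v::euclidean_space"
  shows "(\<integral>x. (x \<bullet> a) * (x \<bullet> b) * (x \<bullet> c) * (x \<bullet> d) \<partial>spherical_measure)
    = ((a \<bullet> b) * (c \<bullet> d) + (a \<bullet> c) * (b \<bullet> d) + (a \<bullet> d) * (b \<bullet> c)) / (real DIM('v) * (real DIM('v) + 2))"
proof -
  let ?E = "\<lambda>f::'v \<Rightarrow> real. \<integral>x. f x \<partial>spherical_measure"
  interpret prob_space "spherical_measure :: 'v measure" by (rule prob_space_spherical_measure)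
  have int: "integrable spherical_measure f" if "continuous_on UNIV f" for f :: "'v \<Rightarrow> real"
    by (rule integrable_spherical_continuous[OF that])
  obtain K where K: "\<And>a::'v. ?E (\<lambda>x. (x \<bullet> a) ^ 4) = K * norm a ^ 4"
    using spherical_moment_4_power by blast
  have n4: "norm a ^ 4 = (a \<bullet> a)\<^sup>2" for a :: 'v
    by (simp add: power2_norm_eq_inner[symmetric])
  have sq: "?E (\<lambda>x. (x \<bullet> a)\<^sup>2 * (x \<bullet> b)\<^sup>2) = K / 3 * ((a \<bullet> a) * (b \<bullet> b) + 2 * (a \<bullet> b)\<^sup>2)" for a b :: 'v
  proof -
    \<comment> \<open>With s = x \<bullet> a and t = x \<bullet> b this is (s+t)^4 + (s-t)^4 = 2 s^4
      + 12 s^2 t^2 + 2 t^4.\<close>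
    have "?E (\<lambda>x. (x \<bullet> a)\<^sup>2 * (x \<bullet> b)\<^sup>2)
      = ?E (\<lambda>x. ((x \<bullet> (a + b)) ^ 4 + (x \<bullet> (a - b)) ^ 4 - 2 * (x \<bullet> a) ^ 4 - 2 * (x \<bullet> b) ^ 4) / 12)"
      by (rule arg_cong[where f = ?E], rule ext)
        (simp add: inner_add_right inner_diff_right power4_eq_xxxx power2_eq_square algebra_simps)
    also have "\<dots> = (K * norm (a + b) ^ 4 + K * norm (a - b) ^ 4 - 2 * (K * norm a ^ 4) - 2 * (K * norm b ^ 4)) / 12"
      by (subst integral_divide_zero) (simp add: K int continuous_intros)
    also have "\<dots> = K / 3 * ((a \<bullet> a) * (b \<bullet> b) + 2 * (a \<bullet> b)\<^sup>2)"
      by (simp add: n4 inner_add_left inner_add_right inner_diff_left inner_diff_right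
          inner_commute[of b a] power2_eq_square algebra_simps)
    finally show ?thesis .
  qed
  have mixed: "?E (\<lambda>x. (x \<bullet> a) * (x \<bullet> b) * (x \<bullet> c)\<^sup>2)
      = K / 3 * ((a \<bullet> b) * (c \<bullet> c) + 2 * (a \<bullet> c) * (b \<bullet> c))" for a b c :: 'v
  proof -
    \<comment> \<open>Here and in \<open>full\<close> the identity is (s+t)^2 - (s-t)^2 = 4 s
      t.\<close>
    have "?E (\<lambda>x. (x \<bullet> a) * (x \<bullet> b) * (x \<bullet> c)\<^sup>2)
      = ?E (\<lambda>x. ((x \<bullet> (a + b))\<^sup>2 * (x \<bullet> c)\<^sup>2 - (x \<bullet> (a - b))\<^sup>2 * (x \<bullet> c)\<^sup>2) / 4)"
      by (rule arg_cong[where f = ?E], rule ext)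
        (simp add: inner_add_right inner_diff_right power2_eq_square algebra_simps)
    also have "\<dots> = (?E (\<lambda>x. (x \<bullet> (a + b))\<^sup>2 * (x \<bullet> c)\<^sup>2) - ?E (\<lambda>x. (x \<bullet> (a - b))\<^sup>2 * (x \<bullet> c)\<^sup>2)) / 4"
      by (subst integral_divide_zero) (simp add: int continuous_intros)
    also have "\<dots> = K / 3 * ((a \<bullet> b) * (c \<bullet> c) + 2 * (a \<bullet> c) * (b \<bullet> c))"
      by (simp only: sq, simp add: inner_add_left inner_add_right inner_diff_left inner_diff_right
          inner_commute[of b a] power2_eq_square algebra_simps)
    finally show ?thesis .
  qed
  have full: "?E (\<lambda>x. (x \<bullet> a) * (x \<bullet> b) * (x \<bullet> c) * (x \<bullet> d))
      = K / 3 * ((a \<bullet> b) * (c \<bullet> d) + (a \<bullet> c) * (b \<bullet> d) + (a \<bullet> d) * (b \<bullet> c))" for a b c d :: 'v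
  proof -
    have "?E (\<lambda>x. (x \<bullet> a) * (x \<bullet> b) * (x \<bullet> c) * (x \<bullet> d))
      = ?E (\<lambda>x. ((x \<bullet> a) * (x \<bullet> b) * (x \<bullet> (c + d))\<^sup>2 - (x \<bullet> a) * (x \<bullet> b) * (x \<bullet> (c - d))\<^sup>2) / 4)"
      by (rule arg_cong[where f = ?E], rule ext)
        (simp add: inner_add_right inner_diff_right power2_eq_square algebra_simps)
    also have "\<dots> = (?E (\<lambda>x. (x \<bullet> a) * (x \<bullet> b) * (x \<bullet> (c + d))\<^sup>2)
        - ?E (\<lambda>x. (x \<bullet> a) * (x \<bullet> b) * (x \<bullet> (c - d))\<^sup>2)) / 4"
      by (subst integral_divide_zero) (simp add: int continuous_intros)
    also have "\<dots> = K / 3 * ((a \<bullet> b) * (c \<bullet> d) + (a \<bullet> c) * (b \<bullet> d) + (a \<bullet> d) * (b \<bullet> c))"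
      by (simp only: mixed, simp add: inner_add_left inner_add_right inner_diff_left inner_diff_right
          inner_commute[of d c] power2_eq_square algebra_simps)
    finally show ?thesis .
  qed
  have norm_sq: "(\<Sum>b\<in>Basis. (x \<bullet> b)\<^sup>2) = (norm x)\<^sup>2" for x :: 'v
    unfolding power2_norm_eq_inner euclidean_inner[of x x] by (simp add: power2_eq_square)
  \<comment> \<open>Normalization: |x|^4 is 1 on the sphere, while its expansion in coordinates has,
    by \<open>sq\<close>, the integral \<open>K / 3\<close> times n (n + 2), where n is the
    dimension.\<close>
  have "1 = ?E (\<lambda>x. (\<Sum>a\<in>Basis. \<Sum>b\<in>Basis. (x \<bullet> a)\<^sup>2 * (x \<bullet> b)\<^sup>2))"
  proof -
    have "?E (\<lambda>x. (\<Sum>a\<in>Basis. \<Sum>b\<in>Basis. (x \<bullet> a)\<^sup>2 * (x \<bullet> b)\<^sup>2)) = ?E (\<lambda>x. 1)"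
      by (rule integral_spherical_cong)
        (auto intro!: continuous_intros simp: norm_sq simp flip: sum_product)
    then show ?thesis using prob_space by simp
  qed
  also have "\<dots> = (\<Sum>a\<in>(Basis::'v set). \<Sum>b\<in>Basis. K / 3 * ((a \<bullet> a) * (b \<bullet> b) + 2 * (a \<bullet> b)\<^sup>2))"
    by (subst Bochner_Integration.integral_sum, intro int continuous_intros)+ (simp add: sq)
  also have "\<dots> = (\<Sum>a\<in>(Basis::'v set). K / 3 * (real DIM('v) + 2))"
  proof (rule sum.cong)
    fix a :: 'v assume a: "a \<in> Basis"
    have "(\<Sum>b\<in>Basis. K / 3 * ((a \<bullet> a) * (b \<bullet> b) + 2 * (a \<bullet> b)\<^sup>2))
        = K / 3 * (\<Sum>b\<in>Basis. (1 + 2 * (a \<bullet> b)\<^sup>2))"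
      using a unfolding sum_distrib_left by (intro sum.cong) auto
    also have "(\<Sum>b\<in>Basis. (1 + 2 * (a \<bullet> b)\<^sup>2)) = real DIM('v) + 2 * (\<Sum>b\<in>Basis. (a \<bullet> b)\<^sup>2)"
      unfolding sum_distrib_left sum.distrib by simp
    finally show "(\<Sum>b\<in>Basis. K / 3 * ((a \<bullet> a) * (b \<bullet> b) + 2 * (a \<bullet> b)\<^sup>2)) = K / 3 * (real DIM('v) + 2)"
      using a by (simp add: norm_sq)
  qed simp
  also have "\<dots> = K / 3 * (real DIM('v) * (real DIM('v) + 2))"
    by simp
  finally have "K / 3 * (real DIM('v) * (real DIM('v) + 2)) = 1" ..
  moreover have "real DIM('v) * (real DIM('v) + 2) \<noteq> 0"
    by (simp add: add_nonneg_eq_0_iff)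
  ultimately have "K / 3 = 1 / (real DIM('v) * (real DIM('v) + 2))"
    by (simp only: eq_divide_eq) simp
  with full show ?thesis by simp
qed

text \<open>Of the three pairings in \<open>spherical_moment_4\<close>, one yields the product of
  the traces. The other two each yield the trace of AC, one by orthonormality of the basis, the
  other by self-adjointness of C and Parseval.\<close>

lemma spherical_moment_quadratic_forms:
  fixes A C :: "'v::euclidean_space \<Rightarrow> 'v"
  assumes "linear A" "linear C" and A: "\<And>x y. A x \<bullet> y = x \<bullet> A y" and C: "\<And>x y. C x \<bullet> y = x \<bullet> C y"
  shows "(\<integral>x. (x \<bullet> A x) * (x \<bullet> C x) \<partial>spherical_measure)
    = ((\<Sum>b\<in>Basis. b \<bullet> A b) * (\<Sum>b\<in>Basis. b \<bullet> C b) + 2 * (\<Sum>b\<in>Basis. A b \<bullet> C b))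
      / (real DIM('v) * (real DIM('v) + 2))"
proof -
  let ?n = "real DIM('v) * (real DIM('v) + 2)"
  have expand: "x \<bullet> A x = (\<Sum>b\<in>Basis. (x \<bullet> b) * (x \<bullet> A b))" "x \<bullet> C x = (\<Sum>b\<in>Basis. (x \<bullet> b) * (x \<bullet> C b))" for x
    by (simp_all add: euclidean_inner[of x "A x"] euclidean_inner[of x "C x"] A C)
  have "(\<integral>x. (x \<bullet> A x) * (x \<bullet> C x) \<partial>spherical_measure)
     = (\<integral>x. (\<Sum>b\<in>Basis. \<Sum>c\<in>Basis. (x \<bullet> b) * (x \<bullet> A b) * (x \<bullet> c) * (x \<bullet> C c)) \<partial>spherical_measure)"
    by (simp only: expand sum_product mult.assoc)
  also have "\<dots> = (\<Sum>b\<in>Basis. \<Sum>c\<in>Basis. \<integral>x. (x \<bullet> b) * (x \<bullet> A b) * (x \<bullet> c) * (x \<bullet> C c) \<partial>spherical_measure)"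
    by (subst Bochner_Integration.integral_sum, intro integrable_spherical_continuous continuous_intros)+ simp
  also have "\<dots> = (\<Sum>b\<in>Basis. \<Sum>c\<in>Basis. ((b \<bullet> A b) * (c \<bullet> C c) + (b \<bullet> c) * (A b \<bullet> C c) + (b \<bullet> C c) * (A b \<bullet> c))) / ?n"
    by (simp add: spherical_moment_4 sum_divide_distrib)
  also have "(\<Sum>b\<in>Basis. \<Sum>c\<in>Basis. ((b \<bullet> A b) * (c \<bullet> C c) + (b \<bullet> c) * (A b \<bullet> C c) + (b \<bullet> C c) * (A b \<bullet> c)))
      = (\<Sum>b\<in>Basis. b \<bullet> A b) * (\<Sum>b\<in>Basis. b \<bullet> C b) + (\<Sum>b\<in>Basis. \<Sum>c\<in>Basis. (b \<bullet> c) * (A b \<bullet> C c))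
        + (\<Sum>b\<in>Basis. \<Sum>c\<in>Basis. (C b \<bullet> c) * (A b \<bullet> c))"
    by (simp add: sum.distrib sum_product C)
  also have "(\<Sum>b\<in>Basis. \<Sum>c\<in>Basis. (C b \<bullet> c) * (A b \<bullet> c)) = (\<Sum>b\<in>Basis. A b \<bullet> C b)"
    by (simp add: euclidean_inner[of "A _" "C _"] mult.commute)
  also have "(\<Sum>b\<in>Basis. \<Sum>c\<in>Basis. (b \<bullet> c) * (A b \<bullet> C c)) = (\<Sum>b\<in>Basis. A b \<bullet> C b)"
  proof (rule sum.cong)
    fix b :: 'v assume b: "b \<in> Basis"
    have "(\<Sum>c\<in>Basis. (b \<bullet> c) * (A b \<bullet> C c)) = (\<Sum>c\<in>Basis. if c = b then A b \<bullet> C c else 0)"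
      using b by (intro sum.cong) (auto simp: inner_Basis)
    then show "(\<Sum>c\<in>Basis. (b \<bullet> c) * (A b \<bullet> C c)) = A b \<bullet> C b"
      using b by simp
  qed simp
  finally show ?thesis by simp
qed

section \<open>Homogeneous polynomials\<close>

lemma homogeneous_poly_continuous: "homogeneous_poly k f \<Longrightarrow> continuous_on UNIV f"
  by (simp add: homogeneous_poly_def continuous_on_polymonial_function real_polynomial_function_eq)

lemma homogeneous_poly_zero: "homogeneous_poly k (\<lambda>x. 0)"
  by (auto simp: homogeneous_poly_def)

lemma homogeneous_poly_uminus: "homogeneous_poly k f \<Longrightarrow> f (- x) = (- 1) ^ k * f x"
  by (metis homogeneous_poly_def scaleR_minus1_left)

lemma homogeneous_poly_mult:
  "homogeneous_poly k f \<Longrightarrow> homogeneous_poly l g \<Longrightarrow> homogeneous_poly (k + l) (\<lambda>x. f x * g x)"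
  by (auto simp: homogeneous_poly_def power_add)

lemma homogeneous_poly_quadratic_form:
  fixes A :: "'v::euclidean_space \<Rightarrow> 'v"
  assumes "linear A"
  shows "homogeneous_poly 2 (\<lambda>x. x \<bullet> A x)"
proof -
  have "real_polynomial_function (\<lambda>x. \<Sum>b\<in>Basis. (x \<bullet> b) * (A x \<bullet> b))"
    using assms
    by (intro real_polynomial_function_sum real_polynomial_function.intros(1,4)
        bounded_linear_inner_left bounded_linear_compose[OF bounded_linear_inner_left])
      (auto simp: linear_conv_bounded_linear)
  then show ?thesis
    using assms by (simp add: homogeneous_poly_def linear_cmul power2_eq_square flip: euclidean_inner)
qed

text \<open>The new factor is 1 on the sphere, so moments of degree 0 and 2 become quartic moments
  and those of degree 1 become cubic ones.\<close>

lemma homogeneous_poly_raise: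
  fixes f :: "'v::euclidean_space \<Rightarrow> real"
  assumes "homogeneous_poly k f"
  shows "homogeneous_poly (2 * j + k) (\<lambda>x. (x \<bullet> x) ^ j * f x)"
proof (induction j)
  case (Suc j)
  have "homogeneous_poly (2 + (2 * j + k)) (\<lambda>x::'v. (x \<bullet> x) * ((x \<bullet> x) ^ j * f x))"
    by (rule homogeneous_poly_mult[OF homogeneous_poly_quadratic_form Suc.IH]) (simp add: linear_iff)
  then show ?case by (simp add: mult.assoc)
qed (simp add: assms)

lemma homogeneous_poly_degree_le: "homogeneous_poly k f \<Longrightarrow> k \<le> t \<Longrightarrow> poly_degree_le t f"
  unfolding poly_degree_le_def
  by (rule exI[of _ "\<lambda>j. if j = k then f else (\<lambda>x. 0)"]) (auto simp: homogeneous_poly_zero sum.If_cases if_distrib[of "\<lambda>g. g _"] cong: if_cong)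

lemma integral_spherical_odd:
  fixes f :: "'v::euclidean_space \<Rightarrow> real"
  assumes f: "homogeneous_poly k f" and "odd k"
  shows "(\<integral>x. f x \<partial>spherical_measure) = 0"
proof -
  have "(\<integral>x. f (- x) \<partial>spherical_measure) = (\<integral>x. f x \<partial>spherical_measure)"
    using homogeneous_poly_continuous[OF f]
    by (intro integral_spherical_orthogonal[of uminus]) (auto simp: orthogonal_transformation_def intro!: linearI)
  then show ?thesis
    using homogeneous_poly_uminus[OF f] \<open>odd k\<close> by simp
qed

lemma expectation_polynomial:
  fixes \<nu> :: "'v::euclidean_space pmf"
  assumes "finite (set_pmf \<nu>)" and "\<And>k. k \<le> t \<Longrightarrow> homogeneous_poly k (p k)"
    and "\<And>k. k \<le> t \<Longrightarrow> measure_pmf.expectation \<nu> (p k) = (\<integral>x. p k x \<partial>spherical_measure)"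
  shows "measure_pmf.expectation \<nu> (\<lambda>x. \<Sum>k\<le>t. p k x) = (\<integral>x. (\<Sum>k\<le>t. p k x) \<partial>spherical_measure)"
proof -
  have "integrable spherical_measure (p k)" if "k \<le> t" for k
    using assms(2)[OF that] by (intro integrable_spherical_continuous homogeneous_poly_continuous)
  then show ?thesis
    using assms by (simp add: Bochner_Integration.integral_sum integrable_measure_pmf_finite)
qed

lemma weighted_spherical_designI:
  fixes \<nu> :: "'v::euclidean_space pmf"
  assumes "finite (set_pmf \<nu>)" "set_pmf \<nu> \<subseteq> sphere 0 1"
    and "\<And>k p. k \<le> t \<Longrightarrow> homogeneous_poly k p
      \<Longrightarrow> measure_pmf.expectation \<nu> p = (\<integral>x. p x \<partial>spherical_measure)"
  shows "weighted_spherical_design t \<nu>"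
  unfolding weighted_spherical_design_def
proof (intro conjI allI impI assms(1,2))
  fix f :: "'v \<Rightarrow> real" assume "poly_degree_le t f"
  then obtain p where p: "\<forall>k\<le>t. homogeneous_poly k (p k)" and f: "f = (\<lambda>x. \<Sum>k\<le>t. p k x)"
    unfolding poly_degree_le_def by blast
  show "measure_pmf.expectation \<nu> f = (\<integral>x. f x \<partial>spherical_measure)"
    unfolding f using p assms by (intro expectation_polynomial) auto
qed

text \<open>Averaging over x and -x cancels the odd components of any given decomposition, so
  replacing them by zero leaves the sum equal to f.\<close>

lemma poly_degree_le_even:
  fixes f :: "'v::euclidean_space \<Rightarrow> real"
  assumes "poly_degree_le t f" and even: "\<And>x. f (- x) = f x"
  obtains p where "\<And>k. k \<le> t \<Longrightarrow> homogeneous_poly k (p k)"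
    "\<And>k. odd k \<Longrightarrow> p k = (\<lambda>x. 0)" "f = (\<lambda>x. \<Sum>k\<le>t. p k x)"
proof -
  obtain p where p: "\<And>k. k \<le> t \<Longrightarrow> homogeneous_poly k (p k)" and f: "\<And>x. f x = (\<Sum>k\<le>t. p k x)"
    using assms(1) unfolding poly_degree_le_def by blast
  define p' where "p' k = (if even k then p k else (\<lambda>x. 0))" for k
  have "f x = (\<Sum>k\<le>t. p' k x)" for x
  proof -
    have "f x = (f x + f (- x)) / 2" by (simp add: even)
    also have "\<dots> = (\<Sum>k\<le>t. (p k x + p k (- x)) / 2)"
      by (simp add: f sum.distrib flip: sum_divide_distrib)
    also have "\<dots> = (\<Sum>k\<le>t. p' k x)"
      by (intro sum.cong refl) (simp add: p'_def homogeneous_poly_uminus[OF p])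
    finally show ?thesis .
  qed
  then show ?thesis
    by (intro that[of p']) (auto simp: p'_def p homogeneous_poly_zero)
qed

section \<open>The Laplacian of a cubic form\<close>

text \<open>No symmetry is demanded: multiplying two expansions, as done below, produces
  nonsymmetric forms.\<close>

definition trilinear :: "('v::real_vector \<Rightarrow> 'v \<Rightarrow> 'v \<Rightarrow> real) \<Rightarrow> bool" where
  "trilinear T \<longleftrightarrow> (\<forall>x. bilinear (T x)) \<and> (\<forall>y z. linear (\<lambda>x. T x y z))"

text \<open>The Taylor expansion of order 3 at 0. The remainder along each line is a polynomial multiple of
  \<open>t ^ 4\<close>; this form is stable under products.\<close>

lemma real_polynomial_function_expansion:
  fixes f :: "'v::real_normed_vector \<Rightarrow> real"
  assumes "real_polynomial_function f"
  shows "\<exists>c L Q T. linear L \<and> bilinear Q \<and> trilinear T \<and>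
    (\<forall>x. \<exists>p. \<forall>t. f (t *\<^sub>R x) = poly (pCons c (pCons (L x) (pCons (Q x x) (pCons (T x x x) p)))) t)"
  using assms
proof induction
  case (linear f)
  then have "linear f" by (simp add: bounded_linear.linear)
  then show ?case
    by (intro exI[of _ 0] exI[of _ f] exI[of _ "\<lambda>_ _. 0"] exI[of _ "\<lambda>_ _ _. 0"])
      (auto simp: trilinear_def bilinear_def linear_iff intro!: exI[of _ 0])
next
  case (const c)
  show ?case
    by (intro exI[of _ c] exI[of _ "\<lambda>_. 0"] exI[of _ "\<lambda>_ _. 0"] exI[of _ "\<lambda>_ _ _. 0"])
      (auto simp: trilinear_def bilinear_def linear_iff intro!: exI[of _ 0])
next
  case (add f g)
  then obtain c L Q T c' L' Q' T' where
    lin: "linear L" "bilinear Q" "trilinear T" "linear L'" "bilinear Q'" "trilinear T'"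
    and f: "\<And>x. \<exists>p. \<forall>t. f (t *\<^sub>R x) = poly (pCons c (pCons (L x) (pCons (Q x x) (pCons (T x x x) p)))) t"
    and g: "\<And>x. \<exists>p. \<forall>t. g (t *\<^sub>R x) = poly (pCons c' (pCons (L' x) (pCons (Q' x x) (pCons (T' x x x) p)))) t"
    by blast
  have "\<exists>p. \<forall>t. f (t *\<^sub>R x) + g (t *\<^sub>R x)
      = poly (pCons (c + c') (pCons (L x + L' x) (pCons (Q x x + Q' x x) (pCons (T x x x + T' x x x) p)))) t" for x
  proof -
    obtain p p' where "\<forall>t. f (t *\<^sub>R x) = poly (pCons c (pCons (L x) (pCons (Q x x) (pCons (T x x x) p)))) t"
      "\<forall>t. g (t *\<^sub>R x) = poly (pCons c' (pCons (L' x) (pCons (Q' x x) (pCons (T' x x x) p')))) t"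
      using f g by metis
    then show ?thesis
      by (intro exI[of _ "p + p'"]) (simp add: algebra_simps)
  qed
  moreover have "linear (\<lambda>x. L x + L' x)" "bilinear (\<lambda>x y. Q x y + Q' x y)"
    "trilinear (\<lambda>x y z. T x y z + T' x y z)"
    using lin by (simp_all add: trilinear_def bilinear_def linear_iff algebra_simps)
  ultimately show ?case by blast
next
  case (mult f g)
  then obtain c L Q T c' L' Q' T' where
    lin: "linear L" "bilinear Q" "trilinear T" "linear L'" "bilinear Q'" "trilinear T'"
    and f: "\<And>x. \<exists>p. \<forall>t. f (t *\<^sub>R x) = poly (pCons c (pCons (L x) (pCons (Q x x) (pCons (T x x x) p)))) t"
    and g: "\<And>x. \<exists>p. \<forall>t. g (t *\<^sub>R x) = poly (pCons c' (pCons (L' x) (pCons (Q' x x) (pCons (T' x x x) p)))) t"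
    by blast
  have "\<exists>p. \<forall>t. f (t *\<^sub>R x) * g (t *\<^sub>R x)
      = poly (pCons (c * c') (pCons (c * L' x + L x * c') (pCons (c * Q' x x + L x * L' x + Q x x * c')
          (pCons (c * T' x x x + L x * Q' x x + Q x x * L' x + T x x x * c') p)))) t" for x
  proof -
    obtain p p' where p: "\<forall>t. f (t *\<^sub>R x) = poly (pCons c (pCons (L x) (pCons (Q x x) (pCons (T x x x) p)))) t"
      "\<forall>t. g (t *\<^sub>R x) = poly (pCons c' (pCons (L' x) (pCons (Q' x x) (pCons (T' x x x) p')))) t"
      using f g by metis
    \<comment> \<open>\<open>r\<close> collects the terms of degree at least 4 of the product,
      divided by t^4.\<close>
    define r where "r = smult c p' + smult (L x) (pCons (T' x x x) p')
      + smult (Q x x) (pCons (Q' x x) (pCons (T' x x x) p'))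
      + smult (T x x x) (pCons (L' x) (pCons (Q' x x) (pCons (T' x x x) p')))
      + p * pCons c' (pCons (L' x) (pCons (Q' x x) (pCons (T' x x x) p')))"
    show ?thesis
      by (rule exI[of _ r]) (simp add: p r_def algebra_simps)
  qed
  moreover have "linear (\<lambda>x. c * L' x + L x * c')" "bilinear (\<lambda>x y. c * Q' x y + L x * L' y + Q x y * c')"
    "trilinear (\<lambda>x y z. c * T' x y z + L x * Q' y z + Q x y * L' z + T x y z * c')"
    using lin by (simp_all add: trilinear_def bilinear_def linear_iff algebra_simps)
  ultimately show ?case
    by (intro exI[of _ "c * c'"] exI[of _ "\<lambda>x. c * L' x + L x * c'"]
        exI[of _ "\<lambda>x y. c * Q' x y + L x * L' y + Q x y * c'"]
        exI[of _ "\<lambda>x y z. c * T' x y z + L x * Q' y z + Q x y * L' z + T x y z * c'"]) simp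
qed

lemma homogeneous_cubic_trilinear:
  assumes "homogeneous_poly 3 f"
  obtains T where "trilinear T" "\<And>x. f x = T x x x"
proof -
  obtain c L Q T where T: "trilinear T" and
    f: "\<And>x. \<exists>p. \<forall>t. f (t *\<^sub>R x) = poly (pCons c (pCons (L x) (pCons (Q x x) (pCons (T x x x) p)))) t"
    using real_polynomial_function_expansion assms unfolding homogeneous_poly_def by metis
  have "f x = T x x x" for x
  proof -
    obtain p where "\<forall>t. f (t *\<^sub>R x) = poly (pCons c (pCons (L x) (pCons (Q x x) (pCons (T x x x) p)))) t"
      using f by blast
    \<comment> \<open>By homogeneity f(tx) is the polynomial f(x) t^3 in t. Real polynomials with
      equal values have equal coefficients, and those of t^3 are compared.\<close>
    then have "poly (monom (f x) 3) = poly (pCons c (pCons (L x) (pCons (Q x x) (pCons (T x x x) p))))"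
      using assms by (intro ext) (simp add: homogeneous_poly_def poly_monom mult.commute)
    then have "monom (f x) 3 = pCons c (pCons (L x) (pCons (Q x x) (pCons (T x x x) p)))"
      by (simp only: poly_eq_poly_eq_iff)
    then have "coeff (monom (f x) 3) 3 = T x x x"
      by (simp add: numeral_3_eq_3)
    then show ?thesis by simp
  qed
  with T that show ?thesis by blast
qed

lemma deriv2_cubic:
  fixes c0 c1 c2 c3 :: real
  shows "(deriv ^^ 2) (\<lambda>t. c0 + c1 * t + c2 * t\<^sup>2 + c3 * t ^ 3) 0 = 2 * c2"
proof -
  have "deriv (\<lambda>t. c0 + c1 * t + c2 * t\<^sup>2 + c3 * t ^ 3) = (\<lambda>t. c1 + 2 * c2 * t + 3 * c3 * t\<^sup>2)"
    by (rule ext, rule DERIV_imp_deriv) (auto intro!: derivative_eq_intros simp: power2_eq_square)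
  moreover have "deriv (\<lambda>t. c1 + 2 * c2 * t + 3 * c3 * t\<^sup>2) 0 = 2 * c2"
    by (rule DERIV_imp_deriv) (auto intro!: derivative_eq_intros)
  ultimately show ?thesis by (simp add: numeral_2_eq_2)
qed

text \<open>Only the diagonal u = v is the second derivative of T(x,x,x). As T need not be
  symmetric, the form need not be symmetric in u and v, but its trace over an orthonormal basis is
  the Laplacian.\<close>

definition trilinear_hessian :: "('v \<Rightarrow> 'v \<Rightarrow> 'v \<Rightarrow> real) \<Rightarrow> 'v \<Rightarrow> 'v \<Rightarrow> 'v \<Rightarrow> real" where
  "trilinear_hessian T x u v = 2 * (T x u v + T u x v + T u v x)"

lemma deriv2_trilinear:
  assumes "trilinear T"
  shows "(deriv ^^ 2) (\<lambda>t. T (x + t *\<^sub>R v) (x + t *\<^sub>R v) (x + t *\<^sub>R v)) 0 = trilinear_hessian T x v v"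
proof -
  have "(\<lambda>t. T (x + t *\<^sub>R v) (x + t *\<^sub>R v) (x + t *\<^sub>R v))
    = (\<lambda>t. T x x x + (T x x v + T x v x + T v x x) * t + (T x v v + T v x v + T v v x) * t\<^sup>2 + T v v v * t ^ 3)"
    using assms
    by (auto simp: trilinear_def bilinear_def linear_iff power2_eq_square power3_eq_cube algebra_simps)
  then show ?thesis
    by (simp only: deriv2_cubic trilinear_hessian_def)
qed

text \<open>The trace does not depend on the orthonormal basis. Expansion in coordinates reduces
  this to Parseval for the images \<open>g b\<close>.\<close>

lemma bilinear_trace_orthogonal:
  fixes g :: "'v::euclidean_space \<Rightarrow> 'v" and B :: "'v \<Rightarrow> 'v \<Rightarrow> real"
  assumes g: "orthogonal_transformation g" and B: "bilinear B"
  shows "(\<Sum>b\<in>Basis. B (g b) (g b)) = (\<Sum>b\<in>Basis. B b b)"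
proof -
  have expand: "B u v = (\<Sum>c\<in>Basis. \<Sum>d\<in>Basis. (u \<bullet> c) * (v \<bullet> d) * B c d)" for u v
  proof -
    have "B u v = B (\<Sum>c\<in>Basis. (u \<bullet> c) *\<^sub>R c) (\<Sum>d\<in>Basis. (v \<bullet> d) *\<^sub>R d)"
      by (simp only: euclidean_representation)
    also have "\<dots> = (\<Sum>(c, d)\<in>Basis \<times> Basis. B ((u \<bullet> c) *\<^sub>R c) ((v \<bullet> d) *\<^sub>R d))"
      by (rule bilinear_sum[OF B])
    finally show ?thesis
      by (simp add: sum.cartesian_product bilinear_lmul[OF B] bilinear_rmul[OF B] algebra_simps)
  qed
  \<comment> \<open>By surjectivity \<open>c\<close> and \<open>d\<close> are images under
    \<open>g\<close>, which then drops out of every inner product.\<close>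
  have parseval: "(\<Sum>b\<in>Basis. (g b \<bullet> c) * (g b \<bullet> d)) = c \<bullet> d" for c d
  proof -
    obtain c' d' where "g c' = c" "g d' = d"
      using orthogonal_transformation_surj[OF g] by (metis surjD)
    then show ?thesis
      using g euclidean_inner[of c' d'] by (auto simp: orthogonal_transformation_def inner_commute)
  qed
  have "(\<Sum>b\<in>Basis. B (g b) (g b)) = (\<Sum>b\<in>Basis. \<Sum>c\<in>Basis. \<Sum>d\<in>Basis. (g b \<bullet> c) * (g b \<bullet> d) * B c d)"
    by (rule sum.cong[OF refl expand])
  also have "\<dots> = (\<Sum>c\<in>Basis. \<Sum>b\<in>Basis. \<Sum>d\<in>Basis. (g b \<bullet> c) * (g b \<bullet> d) * B c d)"
    by (rule sum.swap)
  also have "\<dots> = (\<Sum>c\<in>Basis. \<Sum>d\<in>Basis. \<Sum>b\<in>Basis. (g b \<bullet> c) * (g b \<bullet> d) * B c d)"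
    by (intro sum.cong refl sum.swap)
  also have "\<dots> = (\<Sum>c\<in>Basis. \<Sum>d\<in>Basis. if c = d then B c d else 0)"
    by (intro sum.cong refl) (simp add: parseval inner_Basis flip: sum_distrib_right)
  finally show ?thesis by simp
qed

lemma linear_laplacian_cubic:
  assumes "homogeneous_poly 3 f"
  shows "linear (laplacian f)"
proof -
  obtain T where T: "trilinear T" "\<And>x. f x = T x x x"
    using homogeneous_cubic_trilinear[OF assms] by blast
  have "laplacian f x = (\<Sum>b\<in>Basis. trilinear_hessian T x b b)" for x
    by (simp add: laplacian_def T(2) deriv2_trilinear[OF T(1)])
  moreover have "linear (\<lambda>x. \<Sum>b\<in>Basis. trilinear_hessian T x b b)"
    using T(1) unfolding trilinear_hessian_def
    by (intro linear_compose_sum ballI) (simp add: trilinear_def bilinear_def linear_iff algebra_simps)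
  ultimately show ?thesis by presburger
qed

text \<open>The trace of the Hessian at \<open>g x\<close> is taken in the rotated basis
  \<open>g b\<close>: the line through \<open>g x\<close> in direction \<open>g b\<close> is the
  image under \<open>g\<close> of the line through \<open>x\<close> in direction \<open>b\<close>,
  and there the invariance of f applies.\<close>

lemma laplacian_cubic_orthogonal:
  assumes "homogeneous_poly 3 f" and g: "orthogonal_transformation g"
    and inv: "\<And>x. f (g x) = f x"
  shows "laplacian f (g x) = laplacian f x"
proof -
  obtain T where T: "trilinear T" "\<And>x. f x = T x x x"
    using homogeneous_cubic_trilinear[OF assms(1)] by blast
  have hess: "(deriv ^^ 2) (\<lambda>t. f (y + t *\<^sub>R v)) 0 = trilinear_hessian T y v v" for y v
    by (simp add: T(2) deriv2_trilinear[OF T(1)])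
  have "bilinear (trilinear_hessian T (g x))"
    using T(1) by (simp add: trilinear_def bilinear_def linear_iff trilinear_hessian_def algebra_simps)
  then have "laplacian f (g x) = (\<Sum>b\<in>Basis. trilinear_hessian T (g x) (g b) (g b))"
    by (simp add: laplacian_def hess bilinear_trace_orthogonal[OF g])
  also have "\<dots> = (\<Sum>b\<in>Basis. (deriv ^^ 2) (\<lambda>t. f (g (x + t *\<^sub>R b))) 0)"
    using g by (simp add: orthogonal_transformation_def linear_add linear_cmul hess)
  finally show ?thesis
    by (simp add: laplacian_def inv)
qed

section \<open>Hermitian matrices and Gram forms\<close>

lemma diag_action_nth [simp]: "diag_action \<rho> g x $ i = \<rho> g (x $ i)"
  by (simp add: diag_action_def)

lemma quat_sel [simp]:
  "qRe 0 = 0" "qI 0 = 0" "qJ 0 = 0" "qK 0 = 0"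
  "qRe 1 = 1" "qI 1 = 0" "qJ 1 = 0" "qK 1 = 0"
  "qRe (a + b) = qRe a + qRe b" "qI (a + b) = qI a + qI b"
  "qJ (a + b) = qJ a + qJ b" "qK (a + b) = qK a + qK b"
  "qRe (a - b) = qRe a - qRe b" "qI (a - b) = qI a - qI b"
  "qJ (a - b) = qJ a - qJ b" "qK (a - b) = qK a - qK b"
  "qRe (r *\<^sub>R a) = r * qRe a" "qI (r *\<^sub>R a) = r * qI a"
  "qJ (r *\<^sub>R a) = r * qJ a" "qK (r *\<^sub>R a) = r * qK a"
  "qRe (qcnj a) = qRe a" "qI (qcnj a) = - qI a" "qJ (qcnj a) = - qJ a" "qK (qcnj a) = - qK a"
  "qRe (a * b) = qRe a * qRe b - qI a * qI b - qJ a * qJ b - qK a * qK b"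
  "qI (a * b) = qRe a * qI b + qI a * qRe b + qJ a * qK b - qK a * qJ b"
  "qJ (a * b) = qRe a * qJ b - qI a * qK b + qJ a * qRe b + qK a * qI b"
  "qK (a * b) = qRe a * qK b + qI a * qJ b - qJ a * qI b + qK a * qRe b"
  by (simp_all add: zero_quat_def one_quat_def plus_quat_def minus_quat_def scaleR_quat_def
      qcnj_def times_quat_def)

lemma quat_Reals: "(\<real> :: quat set) = {a. qI a = 0 \<and> qJ a = 0 \<and> qK a = 0}"
proof -
  have "a \<in> \<real> \<longleftrightarrow> qI a = 0 \<and> qJ a = 0 \<and> qK a = 0" for a
  proof
    assume "qI a = 0 \<and> qJ a = 0 \<and> qK a = 0"
    then have "a = of_real (qRe a)"
      by (simp add: of_real_def quat_eq_iff)
    then show "a \<in> \<real>" by (metis Reals_of_real)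
  next
    assume "a \<in> \<real>"
    then obtain r where "a = of_real r" by (rule Reals_cases)
    then show "qI a = 0 \<and> qJ a = 0 \<and> qK a = 0" by (simp add: of_real_def)
  qed
  then show ?thesis by auto
qed

lemma qcnj_1 [simp]: "qcnj 1 = 1"
  by (simp add: quat_eq_iff)

lemma qcnj_eq_self: "qcnj a = a \<Longrightarrow> a = qRe a *\<^sub>R 1"
  by (auto simp: quat_eq_iff)

lemma re_trace_form_eq: "re_trace_form B C = (\<Sum>i\<in>UNIV. \<Sum>j\<in>UNIV. qRe (B $ i $ j * C $ j $ i))"
  by (simp add: re_trace_form_def trace_def matrix_matrix_mult_def sum_2)

lemma linear_re_trace_form: "linear (re_trace_form B)"
  by (rule linearI) (simp_all add: re_trace_form_eq sum_2 algebra_simps)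

lemma re_trace_form_left_diff_mat1:
  "re_trace_form (B - c *\<^sub>R mat 1) C = re_trace_form B C - c * qRe (trace C)"
  by (simp add: re_trace_form_eq trace_def sum_2 mat_def algebra_simps)

lemma re_trace_form_right_diff_mat1:
  "re_trace_form B (C - c *\<^sub>R mat 1) = re_trace_form B C - c * qRe (trace B)"
  by (simp add: re_trace_form_eq trace_def sum_2 mat_def algebra_simps)

lemma trace_diff_mat1: "trace (B - c *\<^sub>R mat 1 :: quat ^ 2 ^ 2) = trace B - (2 * c) *\<^sub>R 1"
  by (simp add: trace_def sum_2 mat_def quat_eq_iff)

text \<open>For Hermitian B the form is the sum of the squares of all real coordinates of the
  entries, hence definite. This turns vanishing scalar pairings into a vanishing matrix.\<close>

lemma re_trace_form_eq_0_imp: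
  assumes "B \<in> Herm2 D" "re_trace_form B B = 0"
  shows "B = 0"
proof -
  have cnj: "B $ j $ i = qcnj (B $ i $ j)" for i j
    using assms(1) unfolding Herm2_def by blast
  have "re_trace_form B B = (\<Sum>i\<in>UNIV. \<Sum>j\<in>UNIV. (qRe (B $ i $ j))\<^sup>2 + (qI (B $ i $ j))\<^sup>2
      + (qJ (B $ i $ j))\<^sup>2 + (qK (B $ i $ j))\<^sup>2)"
    unfolding re_trace_form_eq by (intro sum.cong refl, subst cnj) (simp add: power2_eq_square)
  then have "\<forall>i j. (qRe (B $ i $ j))\<^sup>2 + (qI (B $ i $ j))\<^sup>2 + (qJ (B $ i $ j))\<^sup>2 + (qK (B $ i $ j))\<^sup>2 = 0"
    using assms(2) by (simp add: sum_nonneg_eq_0_iff sum_nonneg)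
  then show ?thesis
    by (auto simp: vec_eq_iff quat_eq_iff add_nonneg_eq_0_iff)
qed

lemma Herm2_trace_real:
  assumes "B \<in> Herm2 D"
  shows "trace B = qRe (trace B) *\<^sub>R 1"
proof -
  have "B $ i $ i = qRe (B $ i $ i) *\<^sub>R 1" for i
    using assms unfolding Herm2_def by (intro qcnj_eq_self) (metis (mono_tags, lifting) mem_Collect_eq)
  then show ?thesis
    by (simp add: trace_def sum_2 quat_eq_iff)
qed

lemma norm_vec_2_eq_1: "norm (x :: 'a::real_inner ^ 2) = 1 \<longleftrightarrow> x $ 1 \<bullet> x $ 1 + x $ 2 \<bullet> x $ 2 = 1"
  by (simp add: norm_eq_1 inner_vec_def sum_2)

lemma sum_Basis_vec:
  "(\<Sum>b\<in>(Basis :: ('a::euclidean_space ^ 'n) set). F b) = (\<Sum>k\<in>UNIV. \<Sum>u\<in>Basis. F (axis k u))"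
proof -
  have "(\<Sum>b\<in>(Basis :: ('a ^ 'n) set). F b) = (\<Sum>k\<in>UNIV. \<Sum>b\<in>axis k ` Basis. F b)"
    unfolding Basis_vec_def
    by (subst sum.UNION_disjoint[symmetric])
      (auto simp: axis_eq_axis intro!: arg_cong[where f = "sum F"] dest: nonzero_Basis)
  also have "\<dots> = (\<Sum>k\<in>UNIV. \<Sum>u\<in>Basis. F (axis k u))"
    by (intro sum.cong refl sum.reindex_cong[where l = "axis _"]) (auto simp: inj_on_def axis_eq_axis)
  finally show ?thesis .
qed

section \<open>Scalars, the Hermitian form and the operators of Gram forms\<close>

locale hermitian_module =
  fixes G :: "('g, 'r) monoid_scheme" (structure)
    and \<rho> :: "'g \<Rightarrow> 'a::euclidean_space \<Rightarrow> 'a"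
    and D :: "quat set"
    and act :: "'a \<Rightarrow> quat \<Rightarrow> 'a"
    and h :: "'a \<Rightarrow> 'a \<Rightarrow> quat"
  assumes scalars: "endo_scalars G \<rho> D act"
    and form: "invariant_hermitian_form G \<rho> D act h"
begin

lemma D_subspace: "subspace D"
  and one_in_D: "1 \<in> D"
  and qcnj_in_D: "a \<in> D \<Longrightarrow> qcnj a \<in> D"
proof -
  have "D \<in> {\<real>, quat_complexes, UNIV}"
    using scalars by (simp add: endo_scalars_def)
  then show "subspace D" "1 \<in> D" "a \<in> D \<Longrightarrow> qcnj a \<in> D"
    by (auto simp: subspace_def quat_Reals quat_complexes_def)
qed

lemma linear_act: "a \<in> D \<Longrightarrow> linear (\<lambda>x. act x a)"
  using scalars by (auto simp: endo_scalars_def equivariant_endos_def bij_betw_def)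

lemma act_1 [simp]: "act x 1 = x"
  using scalars by (simp add: endo_scalars_def)

lemma form_act: "a \<in> D \<Longrightarrow> b \<in> D \<Longrightarrow> h (act x a) (act y b) = qcnj a * h x y * b"
  and form_cnj: "h y x = qcnj (h x y)"
  and qRe_form: "qRe (h x y) = x \<bullet> y"
  and form_in_D: "h x y \<in> D"
  and form_invariant: "g \<in> carrier G \<Longrightarrow> h (\<rho> g x) (\<rho> g y) = h x y"
  using form unfolding invariant_hermitian_form_def by blast+

lemma form_cnj_sel:
  "qRe (h y x) = qRe (h x y)" "qI (h y x) = - qI (h x y)"
  "qJ (h y x) = - qJ (h x y)" "qK (h y x) = - qK (h x y)"
  by (subst form_cnj, simp)+

lemma form_self: "h u u = (u \<bullet> u) *\<^sub>R 1"
  using qcnj_eq_self[OF form_cnj[symmetric, of u u]] by (simp only: qRe_form)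

lemma inner_act_right: "b \<in> D \<Longrightarrow> x \<bullet> act y b = qRe (h x y * b)"
  using form_act[OF one_in_D, of b x y] qRe_form[of x "act y b"] by simp

text \<open>This is Re(conj(p) b) = Re(p conj(b)) with p = \<open>h x y\<close>.\<close>

lemma inner_act_left: "b \<in> D \<Longrightarrow> act x b \<bullet> y = x \<bullet> act y (qcnj b)"
  by (simp add: inner_act_right qcnj_in_D inner_commute[of "act x b"]) (simp add: form_cnj_sel[of y x])

text \<open>\<open>h u u\<close> is real, so it moves past the scalars on either side.\<close>

lemma inner_act_act: "a \<in> D \<Longrightarrow> b \<in> D \<Longrightarrow> act u a \<bullet> act u b = (u \<bullet> u) * qRe (qcnj a * b)"
proof -
  assume "a \<in> D" "b \<in> D"
  then show ?thesis
    using form_act[of a b u u] qRe_form[of "act u a" "act u b"] by (simp add: form_self algebra_simps)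
qed

text \<open>The self-adjoint operator that represents the quadratic form \<^term>\<open>gram_quadratic h B\<close>.\<close>

definition gram_operator :: "quat ^ 2 ^ 2 \<Rightarrow> 'a ^ 2 \<Rightarrow> 'a ^ 2" where
  "gram_operator B x = (\<chi> j. \<Sum>i\<in>UNIV. act (x $ i) (B $ i $ j))"

lemma Herm2_in_D: "B \<in> Herm2 D \<Longrightarrow> B $ i $ j \<in> D"
  and Herm2_cnj: "B \<in> Herm2 D \<Longrightarrow> qcnj (B $ i $ j) = B $ j $ i"
  unfolding Herm2_def by (blast, metis (mono_tags, lifting) mem_Collect_eq)

lemma linear_gram_operator: "B \<in> Herm2 D \<Longrightarrow> linear (gram_operator B)"
  by (intro linearI)
    (simp_all add: gram_operator_def vec_eq_iff linear_add[OF linear_act] linear_cmul[OF linear_act]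
      Herm2_in_D sum.distrib scaleR_sum_right)

lemma gram_quadratic_eq_operator:
  assumes "B \<in> Herm2 D"
  shows "gram_quadratic h B x = x \<bullet> gram_operator B x"
proof -
  have "x \<bullet> gram_operator B x = (\<Sum>j\<in>UNIV. \<Sum>i\<in>UNIV. qRe (h (x $ j) (x $ i) * B $ i $ j))"
    using assms by (simp add: inner_vec_def gram_operator_def inner_sum_right inner_act_right Herm2_in_D)
  \<comment> \<open>The factors trade places, which the real part does not see.\<close>
  also have "\<dots> = (\<Sum>i\<in>UNIV. \<Sum>j\<in>UNIV. qRe (B $ i $ j * h (x $ j) (x $ i)))"
    by (subst sum.swap) (simp add: algebra_simps)
  finally show ?thesis
    by (simp add: gram_quadratic_def re_trace_form_eq gram_matrix_def)
qed

lemma gram_operator_selfadjoint: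
  assumes "B \<in> Herm2 D"
  shows "gram_operator B x \<bullet> y = x \<bullet> gram_operator B y"
proof -
  have "gram_operator B x \<bullet> y = (\<Sum>j\<in>UNIV. \<Sum>i\<in>UNIV. x $ i \<bullet> act (y $ j) (B $ j $ i))"
    using assms by (simp add: inner_vec_def gram_operator_def inner_sum_left inner_act_left Herm2_in_D Herm2_cnj)
  then show ?thesis
    by (subst (asm) sum.swap) (simp add: inner_vec_def gram_operator_def inner_sum_right)
qed

lemma gram_operator_axis:
  assumes "B \<in> Herm2 D"
  shows "gram_operator B (axis k u) = (\<chi> j. act u (B $ k $ j))"
proof -
  have "act 0 (B $ i $ j) = 0" for i j
    by (rule linear_0[OF linear_act[OF Herm2_in_D[OF assms]]])
  then have "act (axis k u $ i) (B $ i $ j) = (if i = k then act u (B $ k $ j) else 0)" for i j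
    by (simp add: axis_def)
  then show ?thesis
    by (simp add: gram_operator_def)
qed

text \<open>In the basis \<open>axis k u\<close> each of the q unit vectors \<open>u\<close>
  contributes the real part of the diagonal entry \<open>B $ k $ k\<close>.\<close>

lemma trace_gram_operator:
  assumes "B \<in> Herm2 D"
  shows "(\<Sum>b\<in>Basis. b \<bullet> gram_operator B b) = real DIM('a) * qRe (trace B)"
proof -
  have "axis k u \<bullet> gram_operator B (axis k u) = qRe (B $ k $ k)" if "u \<in> Basis" for k u
    using inner_act_act[OF one_in_D Herm2_in_D[OF assms], of u k k] that assms
    by (simp add: gram_operator_axis inner_axis inner_axis')
  then show ?thesis
    by (simp add: sum_Basis_vec trace_def sum_2 algebra_simps)
qed

text \<open>In the same basis, Hermitian symmetry converts the conjugate from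
  \<open>inner_act_act\<close> into the transposed entry.\<close>

lemma trace_gram_operator_mult:
  assumes "B \<in> Herm2 D" "C \<in> Herm2 D"
  shows "(\<Sum>b\<in>Basis. gram_operator B b \<bullet> gram_operator C b) = real DIM('a) * re_trace_form B C"
proof -
  have "gram_operator B (axis k u) \<bullet> gram_operator C (axis k u) = (\<Sum>j\<in>UNIV. qRe (B $ j $ k * C $ k $ j))"
    if "u \<in> Basis" for k u
    using that assms
    by (simp add: gram_operator_axis inner_vec_def inner_act_act Herm2_in_D Herm2_cnj)
  then have "(\<Sum>b\<in>Basis. gram_operator B b \<bullet> gram_operator C b)
     = (\<Sum>k\<in>UNIV. real DIM('a) * (\<Sum>j\<in>UNIV. qRe (B $ j $ k * C $ k $ j)))"
    by (simp add: sum_Basis_vec)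
  then show ?thesis
    by (simp add: re_trace_form_eq sum_distrib_left) (rule sum.swap)
qed

text \<open>The ambient dimension is 2q and both kinds of trace are proportional to q, so one factor
  q cancels. For traceless B and C the value is the right-hand side of the second defect
  equation.\<close>

lemma spherical_moment_gram:
  assumes "B \<in> Herm2 D" "C \<in> Herm2 D"
  shows "(\<integral>x. gram_quadratic h B x * gram_quadratic h C x \<partial>spherical_measure)
    = (real DIM('a) * (qRe (trace B) * qRe (trace C)) + 2 * re_trace_form B C) / (4 * (real DIM('a) + 1))"
proof -
  have "(\<integral>x. gram_quadratic h B x * gram_quadratic h C x \<partial>spherical_measure)
      = (real DIM('a) * qRe (trace B) * (real DIM('a) * qRe (trace C)) + 2 * (real DIM('a) * re_trace_form B C))
        / (2 * real DIM('a) * (2 * real DIM('a) + 2))"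
    unfolding gram_quadratic_eq_operator[OF assms(1)] gram_quadratic_eq_operator[OF assms(2)]
      spherical_moment_quadratic_forms[OF linear_gram_operator[OF assms(1)] linear_gram_operator[OF assms(2)]
        gram_operator_selfadjoint[OF assms(1)] gram_operator_selfadjoint[OF assms(2)]]
      trace_gram_operator[OF assms(1)] trace_gram_operator[OF assms(2)] trace_gram_operator_mult[OF assms]
    by simp
  also have "\<dots> = (real DIM('a) * (real DIM('a) * (qRe (trace B) * qRe (trace C)) + 2 * re_trace_form B C))
      / (real DIM('a) * (4 * (real DIM('a) + 1)))"
    by (rule arg_cong2[where f = "(/)"]) (simp_all add: algebra_simps)
  finally show ?thesis by simp
qed

section \<open>The quadratic defect and traceless parts\<close>

lemma quadratic_defect_traceless:
  assumes "norm x = 1"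
  shows "quadratic_defect h x \<in> traceless_Herm2 D"
proof -
  have "trace (quadratic_defect h x) = 0"
    using assms by (simp add: quadratic_defect_def trace_diff_mat1) (simp add: trace_def sum_2 gram_matrix_def form_self norm_vec_2_eq_1 flip: scaleR_add_left)
  moreover have "quadratic_defect h x $ i $ j \<in> D" for i j
    by (auto simp: quadratic_defect_def gram_matrix_def mat_def form_in_D one_in_D
        intro!: subspace_diff[OF D_subspace] subspace_scale[OF D_subspace])
  moreover have "quadratic_defect h x $ j $ i = qcnj (quadratic_defect h x $ i $ j)" for i j
    using form_cnj_sel[of "x $ j" "x $ i"]
    by (auto simp: quadratic_defect_def gram_matrix_def mat_def quat_eq_iff)
  ultimately show ?thesis
    unfolding traceless_Herm2_def Herm2_def by blast
qed

lemma gram_quadratic_traceless: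
  "B \<in> traceless_Herm2 D \<Longrightarrow> gram_quadratic h B x = re_trace_form B (quadratic_defect h x)"
  by (simp add: quadratic_defect_def re_trace_form_right_diff_mat1 gram_quadratic_def traceless_Herm2_def)

lemma Herm2_traceless_part:
  assumes "B \<in> Herm2 D"
  shows "B - (qRe (trace B) / 2) *\<^sub>R mat 1 \<in> traceless_Herm2 D"
proof -
  have "trace (B - (qRe (trace B) / 2) *\<^sub>R mat 1) = 0"
    using Herm2_trace_real[OF assms] by (simp add: trace_diff_mat1)
  moreover have "(B - (qRe (trace B) / 2) *\<^sub>R mat 1) $ i $ j \<in> D" for i j
    using assms by (auto simp: mat_def one_in_D Herm2_in_D
        intro!: subspace_diff[OF D_subspace] subspace_scale[OF D_subspace])
  moreover have "(B - (qRe (trace B) / 2) *\<^sub>R mat 1) $ j $ i = qcnj ((B - (qRe (trace B) / 2) *\<^sub>R mat 1) $ i $ j)" for i j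
    using Herm2_cnj[OF assms, of i j, symmetric] by (auto simp: mat_def quat_eq_iff)
  ultimately show ?thesis
    unfolding traceless_Herm2_def Herm2_def by blast
qed

text \<open>The Gram matrix is Z + I/2. The constant is the pairing of B with I/2, and the scalar
  part of B pairs to zero with the traceless Z.\<close>

lemma gram_quadratic_eq_defect:
  assumes "B \<in> Herm2 D" "norm x = 1"
  shows "gram_quadratic h B x
    = re_trace_form (B - (qRe (trace B) / 2) *\<^sub>R mat 1) (quadratic_defect h x) + qRe (trace B) / 2"
proof -
  have "trace (quadratic_defect h x) = 0"
    using quadratic_defect_traceless[OF assms(2)] by (simp add: traceless_Herm2_def)
  then have "re_trace_form (B - (qRe (trace B) / 2) *\<^sub>R mat 1) (quadratic_defect h x)
      = re_trace_form B (quadratic_defect h x)"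
    by (simp add: re_trace_form_left_diff_mat1)
  then show ?thesis
    by (simp add: quadratic_defect_def re_trace_form_right_diff_mat1 gram_quadratic_def)
qed

text \<open>With both forms written as traceless part plus constant, the product has a term
  quadratic in Z, evaluated by the second equation, cross terms linear in Z, killed by the first,
  and a constant.\<close>

lemma defect_equations_gram_moment:
  assumes eqs: "defect_equations D h s w x" and x: "\<And>i. i < s \<Longrightarrow> norm (x i) = 1"
    and w: "(\<Sum>i<s. w i) = 1" and B: "B \<in> Herm2 D" and C: "C \<in> Herm2 D"
  shows "(\<Sum>i<s. w i * (gram_quadratic h B (x i) * gram_quadratic h C (x i)))
    = (\<integral>x. gram_quadratic h B x * gram_quadratic h C x \<partial>spherical_measure)"
proof -
  define \<beta> \<gamma> where "\<beta> = qRe (trace B) / 2" and "\<gamma> = qRe (trace C) / 2"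
  define B' C' where "B' = B - \<beta> *\<^sub>R mat 1" and "C' = C - \<gamma> *\<^sub>R mat 1"
  have B': "B' \<in> traceless_Herm2 D" and C': "C' \<in> traceless_Herm2 D"
    using Herm2_traceless_part B C by (auto simp: B'_def C'_def \<beta>_def \<gamma>_def)
  have first: "(\<Sum>i<s. w i * re_trace_form M (quadratic_defect h (x i))) = 0" for M
  proof -
    have "re_trace_form M (\<Sum>i<s. w i *\<^sub>R quadratic_defect h (x i)) = 0"
      using eqs by (simp add: defect_equations_def linear_0[OF linear_re_trace_form])
    then show ?thesis
      by (simp add: linear_sum[OF linear_re_trace_form] linear_cmul[OF linear_re_trace_form])
  qed
  have second: "(\<Sum>i<s. w i * re_trace_form B' (quadratic_defect h (x i)) * re_trace_form C' (quadratic_defect h (x i)))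
      = 1 / (2 * (real DIM('a) + 1)) * re_trace_form B' C'"
    using eqs B' C' by (simp add: defect_equations_def)
  have "(\<Sum>i<s. w i * (gram_quadratic h B (x i) * gram_quadratic h C (x i)))
      = (\<Sum>i<s. w i * re_trace_form B' (quadratic_defect h (x i)) * re_trace_form C' (quadratic_defect h (x i))
          + \<gamma> * (w i * re_trace_form B' (quadratic_defect h (x i)))
          + \<beta> * (w i * re_trace_form C' (quadratic_defect h (x i))) + \<beta> * \<gamma> * w i)"
    using gram_quadratic_eq_defect[OF B x] gram_quadratic_eq_defect[OF C x]
    by (intro sum.cong refl) (simp add: B'_def C'_def \<beta>_def \<gamma>_def algebra_simps)
  also have "\<dots> = 1 / (2 * (real DIM('a) + 1)) * re_trace_form B' C' + \<beta> * \<gamma>"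
    by (simp only: sum.distrib second first w flip: sum_distrib_left)
  \<comment> \<open>Scalar and traceless parts are orthogonal, and the scalar parts pair to
    \<beta>\<gamma> tr(I) = 2\<beta>\<gamma>.\<close>
  also have "re_trace_form B' C' = re_trace_form B C - 2 * \<beta> * \<gamma>"
    using C' by (simp add: B'_def re_trace_form_left_diff_mat1 traceless_Herm2_def)
      (simp add: C'_def re_trace_form_right_diff_mat1 \<beta>_def)
  finally show ?thesis
    unfolding spherical_moment_gram[OF B C] by (simp add: \<beta>_def \<gamma>_def field_simps)
qed

end

section \<open>Gram forms as invariant test functions\<close>

context hermitian_module
begin

lemma gram_quadratic_homogeneous: "B \<in> Herm2 D \<Longrightarrow> homogeneous_poly 2 (gram_quadratic h B)"
  using homogeneous_poly_quadratic_form[OF linear_gram_operator, of B] gram_quadratic_eq_operator[of B]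
  by presburger

lemma gram_quadratic_invariant: "invariant_fun G \<rho> (gram_quadratic h B)"
  by (simp add: invariant_fun_def gram_quadratic_def gram_matrix_def form_invariant)

lemma mat1_Herm2: "mat 1 \<in> Herm2 D"
  by (auto simp: Herm2_def mat_def one_in_D subspace_0[OF D_subspace] quat_eq_iff)

text \<open>The form of the identity matrix is 1 on the sphere, so this mean is a fourth moment with
  C = I, and that moment is a multiple of tr B.\<close>

lemma spherical_mean_gram:
  assumes B: "B \<in> traceless_Herm2 D"
  shows "(\<integral>x. gram_quadratic h B x \<partial>spherical_measure) = 0"
proof -
  have B': "B \<in> Herm2 D" and tr: "trace B = 0" using B by (auto simp: traceless_Herm2_def)
  have one: "gram_quadratic h (mat 1) x = 1" if "norm x = 1" for x
    using that by (simp add: gram_quadratic_def re_trace_form_eq gram_matrix_def sum_2 mat_def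
        qRe_form norm_vec_2_eq_1)
  have "(\<integral>x. gram_quadratic h B x \<partial>spherical_measure)
      = (\<integral>x. gram_quadratic h B x * gram_quadratic h (mat 1) x \<partial>spherical_measure)"
    using gram_quadratic_homogeneous[OF B'] gram_quadratic_homogeneous[OF mat1_Herm2]
    by (intro integral_spherical_cong continuous_on_mult homogeneous_poly_continuous) (auto simp: one)
  also have "re_trace_form B (mat 1) = qRe (trace B)"
    by (simp add: re_trace_form_eq trace_def sum_2 mat_def)
  then have "(\<integral>x. gram_quadratic h B x * gram_quadratic h (mat 1) x \<partial>spherical_measure) = 0"
    by (simp add: spherical_moment_gram[OF B' mat1_Herm2] tr)
  finally show ?thesis .
qed

text \<open>It allows the weighted sum of the defects to serve as a test matrix itself.\<close>

lemma subspace_traceless_Herm2: "subspace (traceless_Herm2 D)"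
proof (rule subspaceI)
  show "0 \<in> traceless_Herm2 D"
    by (simp add: traceless_Herm2_def Herm2_def trace_def subspace_0[OF D_subspace] quat_eq_iff)
next
  fix B C assume "B \<in> traceless_Herm2 D" "C \<in> traceless_Herm2 D"
  then have BC: "B \<in> Herm2 D" "C \<in> Herm2 D" "trace B = 0" "trace C = 0"
    by (auto simp: traceless_Herm2_def)
  have "(B + C) $ i $ j \<in> D" for i j
    using BC by (simp add: Herm2_in_D subspace_add[OF D_subspace])
  moreover have "(B + C) $ j $ i = qcnj ((B + C) $ i $ j)" for i j
    using Herm2_cnj[OF BC(1), of i j] Herm2_cnj[OF BC(2), of i j] by (auto simp: quat_eq_iff)
  moreover have "trace (B + C) = trace B + trace C"
    by (simp add: trace_def sum.distrib)
  then have "trace (B + C) = 0"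
    using BC by simp
  ultimately show "B + C \<in> traceless_Herm2 D"
    unfolding traceless_Herm2_def Herm2_def by blast
next
  fix c :: real and B assume "B \<in> traceless_Herm2 D"
  then have B: "B \<in> Herm2 D" "trace B = 0"
    by (auto simp: traceless_Herm2_def)
  have "(c *\<^sub>R B) $ i $ j \<in> D" for i j
    using B by (simp add: Herm2_in_D subspace_scale[OF D_subspace])
  moreover have "(c *\<^sub>R B) $ j $ i = qcnj ((c *\<^sub>R B) $ i $ j)" for i j
    using Herm2_cnj[OF B(1), of i j, symmetric] by (auto simp: quat_eq_iff)
  moreover have "trace (c *\<^sub>R B) = c *\<^sub>R trace B"
    by (simp add: trace_def scaleR_sum_right)
  then have "trace (c *\<^sub>R B) = 0"
    using B by simp
  ultimately show "c *\<^sub>R B \<in> traceless_Herm2 D"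
    unfolding traceless_Herm2_def Herm2_def by blast
qed

end

section \<open>Group averages and orbit mixtures\<close>

locale finite_orthogonal_module =
  fixes G :: "('g, 'r) monoid_scheme" (structure)
    and \<rho> :: "'g \<Rightarrow> 'a::euclidean_space \<Rightarrow> 'a"
  assumes finite_G: "finite (carrier G)"
    and module: "orthogonal_module G \<rho>"
begin

sublocale action: group_action G UNIV \<rho>
  using module by (simp add: orthogonal_module_def)

sublocale group G
  using action.group_hom by (simp add: group_hom_def)

lemma orthogonal_rho: "g \<in> carrier G \<Longrightarrow> orthogonal_transformation (\<rho> g)"
  using module by (simp add: orthogonal_module_def)

lemma diag_orthogonal: "g \<in> carrier G \<Longrightarrow> orthogonal_transformation (diag_action \<rho> g)"
  using orthogonal_rho[of g]
  by (auto simp: orthogonal_transformation_def inner_vec_def vec_eq_iff linear_add linear_cmul intro!: linearI)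

lemma diag_mult:
  "g \<in> carrier G \<Longrightarrow> k \<in> carrier G \<Longrightarrow> diag_action \<rho> (g \<otimes> k) x = diag_action \<rho> g (diag_action \<rho> k x)"
  by (simp add: vec_eq_iff action.composition_rule)

lemma norm_diag: "g \<in> carrier G \<Longrightarrow> norm (diag_action \<rho> g x) = norm x"
  by (simp add: orthogonal_transformation_norm diag_orthogonal)

lemma card_G_pos: "card (carrier G) > 0"
  using finite_G by (auto simp: card_gt_0_iff)

definition group_average :: "('a ^ 2 \<Rightarrow> real) \<Rightarrow> 'a ^ 2 \<Rightarrow> real" where
  "group_average f x = (\<Sum>g\<in>carrier G. f (diag_action \<rho> g x)) / real (card (carrier G))"

lemma group_average_id: "invariant_fun G \<rho> f \<Longrightarrow> group_average f x = f x"
  using card_G_pos by (simp add: group_average_def invariant_fun_def)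

lemma group_average_invariant: "invariant_fun G \<rho> (group_average f)"
  unfolding invariant_fun_def
proof (intro ballI allI)
  fix k x assume k: "k \<in> carrier G"
  have "(\<Sum>g\<in>carrier G. f (diag_action \<rho> g (diag_action \<rho> k x))) = (\<Sum>g\<in>carrier G. f (diag_action \<rho> g x))"
    by (rule sum.reindex_bij_witness[where i = "\<lambda>g. g \<otimes> inv k" and j = "\<lambda>g. g \<otimes> k"])
      (use k in \<open>auto simp: m_assoc diag_mult\<close>)
  then show "group_average f (diag_action \<rho> k x) = group_average f x"
    by (simp add: group_average_def)
qed

lemma homogeneous_poly_group_average:
  assumes "homogeneous_poly k f"
  shows "homogeneous_poly k (group_average f)"
proof -
  have "real_polynomial_function (f \<circ> diag_action \<rho> g)" if "g \<in> carrier G" for g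
    using assms orthogonal_transformation_linear[OF diag_orthogonal[OF that]]
    by (intro real_polynomial_function_compose polynomial_function_bounded_linear)
      (auto simp: homogeneous_poly_def linear_conv_bounded_linear)
  then have "real_polynomial_function (group_average f)"
    using finite_G unfolding group_average_def
    by (intro real_polynomial_function_divide real_polynomial_function_sum) (auto simp: o_def)
  moreover have "group_average f (c *\<^sub>R x) = c ^ k * group_average f x" for c x
    using assms orthogonal_transformation_scaleR[OF diag_orthogonal]
    by (simp add: group_average_def homogeneous_poly_def flip: sum_distrib_left)
  ultimately show ?thesis
    by (simp add: homogeneous_poly_def)
qed

lemma integral_spherical_group_average:
  assumes f: "continuous_on UNIV f"
  shows "(\<integral>x. group_average f x \<partial>spherical_measure) = (\<integral>x. f x \<partial>spherical_measure)"
proof -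
  have "continuous_on UNIV (\<lambda>x. f (diag_action \<rho> g x))" if "g \<in> carrier G" for g
    using f orthogonal_transformation_linear[OF diag_orthogonal[OF that]]
    by (intro continuous_on_compose2[OF f]) (auto intro: linear_continuous_on simp: linear_conv_bounded_linear)
  then have "(\<integral>x. group_average f x \<partial>spherical_measure)
      = (\<Sum>g\<in>carrier G. \<integral>x. f (diag_action \<rho> g x) \<partial>spherical_measure) / real (card (carrier G))"
    unfolding group_average_def
    by (simp add: Bochner_Integration.integral_sum integrable_spherical_continuous)
  then show ?thesis
    using card_G_pos by (simp add: integral_spherical_orthogonal[OF diag_orthogonal f])
qed

section \<open>Expectations over orbits and their mixtures\<close>

abbreviation "orb x \<equiv> orbit G (diag_action \<rho>) x"

lemma finite_orb [simp]: "finite (orb x)" and orb_nonempty [simp]: "orb x \<noteq> {}"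
  using finite_G by (auto simp: orbit_def)

lemma bij_betw_orb: "g \<in> carrier G \<Longrightarrow> bij_betw (diag_action \<rho> g) (orb x) (orb x)"
proof -
  assume g: "g \<in> carrier G"
  then have "diag_action \<rho> g ` orb x \<subseteq> orb x"
    by (auto simp: orbit_def simp flip: diag_mult)
  moreover have "inj_on (diag_action \<rho> g) (orb x)"
    using orthogonal_transformation_inj[OF diag_orthogonal[OF g]] by (rule inj_on_subset) simp
  ultimately show ?thesis
    by (simp add: bij_betw_def endo_inj_surj)
qed

text \<open>Double counting of \<open>f (g y)\<close> over g in G and y in the orbit, without
  stabilizers: each g permutes the orbit, and each y has the same group average as x.\<close>

lemma expectation_orbit:
  fixes f :: "'a ^ 2 \<Rightarrow> real"
  shows "measure_pmf.expectation (pmf_of_set (orb x)) f = group_average f x"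
proof -
  have "real (card (carrier G)) * sum f (orb x) = (\<Sum>g\<in>carrier G. \<Sum>y\<in>orb x. f (diag_action \<rho> g y))"
    by (simp add: sum.reindex_bij_betw[OF bij_betw_orb, of _ f])
  also have "\<dots> = (\<Sum>y\<in>orb x. real (card (carrier G)) * group_average f y)"
    using card_G_pos by (subst sum.swap) (simp add: group_average_def)
  also have "\<dots> = (\<Sum>y\<in>orb x. real (card (carrier G)) * group_average f x)"
    using group_average_invariant[of f] by (intro sum.cong) (auto simp: orbit_def invariant_fun_def)
  finally have "sum f (orb x) = real (card (orb x)) * group_average f x"
    using card_G_pos by (simp add: algebra_simps)
  moreover have "real (card (orb x)) > 0"
    by (simp add: card_gt_0_iff)
  ultimately show ?thesis
    by (simp add: integral_pmf_of_set)
qed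

context
  fixes s :: nat and w :: "nat \<Rightarrow> real" and x :: "nat \<Rightarrow> 'a ^ 2"
  assumes w_pos: "\<And>i. i < s \<Longrightarrow> w i > 0" and w_sum: "(\<Sum>i<s. w i) = 1"
begin

lemma set_orbit_mixture: "set_pmf (orbit_mixture G \<rho> s w x) \<subseteq> (\<Union>i<s. orb (x i))"
proof
  fix y assume "y \<in> set_pmf (orbit_mixture G \<rho> s w x)"
  then have "(\<Sum>i<s. w i * pmf (pmf_of_set (orb (x i))) y) \<noteq> 0"
    by (simp add: set_pmf_eq pmf_orbit_mixture[OF w_pos w_sum])
  then obtain i where "i < s" "w i * pmf (pmf_of_set (orb (x i))) y \<noteq> 0"
    by (meson lessThan_iff sum.neutral)
  then show "y \<in> (\<Union>i<s. orb (x i))"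
    by (auto simp: indicator_def split: if_splits)
qed

lemma finite_set_orbit_mixture: "finite (set_pmf (orbit_mixture G \<rho> s w x))"
  using set_orbit_mixture by (rule finite_subset) simp

lemma set_orbit_mixture_sphere:
  assumes "\<And>i. i < s \<Longrightarrow> norm (x i) = 1"
  shows "set_pmf (orbit_mixture G \<rho> s w x) \<subseteq> sphere 0 1"
  using set_orbit_mixture assms by (fastforce simp: orbit_def norm_diag)

lemma expectation_orbit_mixture:
  fixes f :: "'a ^ 2 \<Rightarrow> real"
  shows "measure_pmf.expectation (orbit_mixture G \<rho> s w x) f = (\<Sum>i<s. w i * group_average f (x i))"
proof -
  \<comment> \<open>One finite set carries all the orbit measures; orbits of different indices may
    coincide.\<close>
  let ?A = "\<Union>i<s. orb (x i)"
  have "measure_pmf.expectation (orbit_mixture G \<rho> s w x) f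
      = (\<Sum>y\<in>?A. f y * pmf (orbit_mixture G \<rho> s w x) y)"
    using set_orbit_mixture by (intro integral_measure_pmf_real) auto
  also have "\<dots> = (\<Sum>i<s. w i * (\<Sum>y\<in>?A. f y * pmf (pmf_of_set (orb (x i))) y))"
    by (simp add: pmf_orbit_mixture[OF w_pos w_sum] sum_distrib_left sum_distrib_right mult_ac)
      (rule sum.swap)
  also have "\<dots> = (\<Sum>i<s. w i * group_average f (x i))"
  proof (rule sum.cong)
    fix i assume "i \<in> {..<s}"
    then have "(\<Sum>y\<in>?A. f y * pmf (pmf_of_set (orb (x i))) y) = measure_pmf.expectation (pmf_of_set (orb (x i))) f"
      by (intro integral_measure_pmf_real[symmetric]) (auto simp: set_pmf_of_set)
    then show "w i * (\<Sum>y\<in>?A. f y * pmf (pmf_of_set (orb (x i))) y) = w i * group_average f (x i)"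
      by (simp add: expectation_orbit)
  qed simp
  finally show ?thesis .
qed

end

text \<open>The kernel is a submodule, so it is 0 or everything. If it were 0, then
  \<open>\<rho> g v - v\<close>, which lies in it by invariance, would vanish for all g and v,
  against nontriviality.\<close>

lemma invariant_linear_functional_zero_component:
  fixes l :: "'a \<Rightarrow> real"
  assumes irr: "irreducible_module G \<rho>" and nontriv: "nontrivial_module G \<rho>"
    and l: "linear l" and inv: "\<And>g u. g \<in> carrier G \<Longrightarrow> l (\<rho> g u) = l u"
  shows "l u = 0"
proof -
  let ?U = "{u. l u = 0}"
  have "subspace ?U" using l by (simp add: subspace_def linear_0 linear_add linear_cmul)
  moreover have "\<forall>g\<in>carrier G. \<rho> g ` ?U \<subseteq> ?U" using inv by auto
  ultimately consider "?U = {0}" | "?U = UNIV"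
    using irr unfolding irreducible_module_def by meson
  then show ?thesis
  proof cases
    case 1
    have "\<rho> g v = v" if "g \<in> carrier G" for g v
    proof -
      have "\<rho> g v - v \<in> ?U" using that inv l by (simp add: linear_diff)
      then show ?thesis using 1 by simp
    qed
    then show ?thesis using nontriv by (auto simp: nontrivial_module_def)
  qed auto
qed

text \<open>The restrictions of the form to the two summands are invariant under
  \<open>\<rho>\<close>, hence zero, and they determine it.\<close>

lemma invariant_linear_functional_zero:
  assumes irr: "irreducible_module G \<rho>" and nontriv: "nontrivial_module G \<rho>"
    and lin: "linear (l :: 'a ^ 2 \<Rightarrow> real)" and inv: "invariant_fun G \<rho> l"
  shows "l x = 0"
proof -
  have "l (axis i u) = 0" for i u
  proof (rule invariant_linear_functional_zero_component[OF irr nontriv])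
    show "linear (\<lambda>u. l (axis i u))"
    proof (rule linearI)
      have "axis i (a + b) = axis i a + (axis i b :: 'a ^ 2)" "axis i (r *\<^sub>R a) = r *\<^sub>R (axis i a :: 'a ^ 2)" for a b r
        by (simp_all add: vec_eq_iff axis_def)
      then show "l (axis i (a + b)) = l (axis i a) + l (axis i b)" "l (axis i (r *\<^sub>R a)) = r *\<^sub>R l (axis i a)" for a b r
        using lin by (simp_all add: linear_add linear_cmul)
    qed
    fix g u assume g: "g \<in> carrier G"
    have "\<rho> g 0 = 0" using orthogonal_rho[OF g] linear_0 orthogonal_transformation_linear by blast
    then have "diag_action \<rho> g (axis i u) = axis i (\<rho> g u)"
      by (simp add: vec_eq_iff axis_def)
    then show "l (axis i (\<rho> g u)) = l (axis i u)"
      using inv g by (metis invariant_fun_def)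
  qed
  moreover have "x = (\<Sum>i\<in>UNIV. axis i (x $ i))"
    by (simp add: vec_eq_iff axis_def)
  ultimately show ?thesis
    using lin by (metis (no_types, lifting) linear_sum sum.neutral)
qed

end

section \<open>Antipodal symmetrization of a finite measure\<close>

lemma antipodalization_finite:
  fixes \<mu> :: "'v::real_vector pmf"
  assumes "finite (set_pmf \<mu>)"
  shows "set_pmf (antipodalization \<mu>) \<subseteq> set_pmf \<mu> \<union> uminus ` set_pmf \<mu>"
    and "measure_pmf.expectation (antipodalization \<mu>) f
      = (measure_pmf.expectation \<mu> f + measure_pmf.expectation \<mu> (\<lambda>x. f (- x))) / (2::real)"
proof -
  let ?A = "set_pmf \<mu> \<union> uminus ` set_pmf \<mu>"
  show sub: "set_pmf (antipodalization \<mu>) \<subseteq> ?A"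
  proof
    fix y assume "y \<in> set_pmf (antipodalization \<mu>)"
    then have "pmf \<mu> y \<noteq> 0 \<or> pmf (map_pmf uminus \<mu>) y \<noteq> 0"
      by (auto simp: set_pmf_eq pmf_antipodalization)
    then have "y \<in> set_pmf \<mu> \<or> y \<in> set_pmf (map_pmf uminus \<mu>)"
      by (simp add: set_pmf_iff del: set_map_pmf)
    then show "y \<in> ?A" by simp
  qed
  have E: "measure_pmf.expectation \<nu> f = (\<Sum>y\<in>?A. f y * pmf \<nu> y)" if "set_pmf \<nu> \<subseteq> ?A" for \<nu>
    using assms that by (intro integral_measure_pmf_real) auto
  have "measure_pmf.expectation (antipodalization \<mu>) f
      = ((\<Sum>y\<in>?A. f y * pmf \<mu> y) + (\<Sum>y\<in>?A. f y * pmf (map_pmf uminus \<mu>) y)) / 2"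
    by (simp add: E[OF sub] pmf_antipodalization sum_divide_distrib algebra_simps add_divide_distrib flip: sum.distrib)
  also have "\<dots> = (measure_pmf.expectation \<mu> f + measure_pmf.expectation (map_pmf uminus \<mu>) f) / 2"
    by (simp add: E del: integral_map_pmf)
  finally show "measure_pmf.expectation (antipodalization \<mu>) f
      = (measure_pmf.expectation \<mu> f + measure_pmf.expectation \<mu> (\<lambda>x. f (- x))) / 2"
    by simp
qed

section \<open>Moments of orbit mixtures\<close>

text \<open>f lies in its own class, and by assumption the only class is the span of the Gram
  products.\<close>

lemma gram_quartics_of_quotient:
  assumes "quartic_quotient G \<rho> D h = {gram_quartics D h}" and f: "f \<in> invariant_quartics G \<rho>"
  shows "f \<in> gram_quartics D h"
proof -
  let ?r = "{(f, f'). f \<in> invariant_quartics G \<rho> \<and> f' \<in> invariant_quartics G \<rho> \<and>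
                 (\<lambda>x. f x - f' x) \<in> gram_quartics D h}"
  have "?r `` {f} \<in> quartic_quotient G \<rho> D h"
    using f unfolding quartic_quotient_def by (rule quotientI)
  then have "?r `` {f} = gram_quartics D h" using assms(1) by simp
  \<comment> \<open>Zero is the sum with \<open>m = 0\<close> terms; this gives reflexivity at
    f.\<close>
  moreover have "(\<lambda>x. f x - f x) \<in> gram_quartics D h"
    by (auto simp: gram_quartics_def intro!: exI[of _ "0::nat"])
  then have "f \<in> ?r `` {f}" using f by simp
  ultimately show ?thesis by simp
qed

locale orbit_design = finite_orthogonal_module G \<rho> + hermitian_module G \<rho> D act h
  for G :: "('g, 'r) monoid_scheme" (structure) and \<rho> :: "'g \<Rightarrow> 'a::euclidean_space \<Rightarrow> 'a" and D act h +
  fixes s :: nat and w :: "nat \<Rightarrow> real" and x :: "nat \<Rightarrow> 'a ^ 2" and \<mu> :: "('a ^ 2) pmf"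
  assumes x_norm: "\<And>i. i < s \<Longrightarrow> norm (x i) = 1"
    and w_pos: "\<And>i. i < s \<Longrightarrow> w i > 0" and w_sum: "(\<Sum>i<s. w i) = 1"
    and mu: "\<mu> = orbit_mixture G \<rho> s w x"
begin

lemma finite_mu: "finite (set_pmf \<mu>)" and mu_sphere: "set_pmf \<mu> \<subseteq> sphere 0 1"
  using finite_set_orbit_mixture[of s w x] set_orbit_mixture_sphere[of s w x] x_norm w_pos w_sum
  by (auto simp: mu)

lemma expectation_mu: "measure_pmf.expectation \<mu> f = (\<Sum>i<s. w i * group_average f (x i))"
  using expectation_orbit_mixture[of s w x] w_pos w_sum by (simp add: mu)

lemma expectation_mu_invariant:
  "invariant_fun G \<rho> f \<Longrightarrow> measure_pmf.expectation \<mu> f = (\<Sum>i<s. w i * f (x i))"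
  by (simp add: expectation_mu group_average_id)

lemma expectation_mu_cong:
  fixes f f' :: "'a ^ 2 \<Rightarrow> real"
  assumes "\<And>x. norm x = 1 \<Longrightarrow> f x = f' x"
  shows "measure_pmf.expectation \<mu> f = measure_pmf.expectation \<mu> f'"
  using mu_sphere assms by (intro integral_cong_AE) (auto simp: AE_measure_pmf_iff)

lemma expectation_mu_uminus:
  fixes f :: "'a ^ 2 \<Rightarrow> real"
  assumes "homogeneous_poly k f"
  shows "measure_pmf.expectation \<mu> (\<lambda>x. f (- x)) = (- 1) ^ k * measure_pmf.expectation \<mu> f"
  by (simp add: homogeneous_poly_uminus[OF assms])

text \<open>The tests are Gram forms of traceless matrices and products of two of them. They are
  invariant, so one evaluation per orbit gives their expectation.\<close>

lemma defect_equations_if_even_moments: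
  assumes ev: "\<And>f. poly_degree_le 4 f \<Longrightarrow> \<forall>v. f (- v) = f v
    \<Longrightarrow> measure_pmf.expectation \<mu> f = (\<integral>v. f v \<partial>spherical_measure)"
  shows "defect_equations D h s w x"
proof -
  have hom: "measure_pmf.expectation \<mu> f = (\<integral>v. f v \<partial>spherical_measure)"
    if "homogeneous_poly k f" "even k" "k \<le> 4" for k f
    using that by (intro ev homogeneous_poly_degree_le) (auto simp: homogeneous_poly_uminus)
  have first: "(\<Sum>i<s. w i * re_trace_form B (quadratic_defect h (x i))) = 0"
    if B: "B \<in> traceless_Herm2 D" for B
  proof -
    have "B \<in> Herm2 D" using B by (simp add: traceless_Herm2_def)
    then have "measure_pmf.expectation \<mu> (gram_quadratic h B) = 0"
      using hom[OF gram_quadratic_homogeneous] spherical_mean_gram[OF B] by simp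
    then show ?thesis
      by (simp add: expectation_mu_invariant gram_quadratic_invariant gram_quadratic_traceless[OF B])
  qed
  \<comment> \<open>The averaged defect is tested against itself: <M,M> is the average of the
    pairings of M with the defects, which is zero by \<open>first\<close>, and definiteness gives M
    = 0.\<close>
  define M where "M = (\<Sum>i<s. w i *\<^sub>R quadratic_defect h (x i))"
  have M: "M \<in> traceless_Herm2 D"
    unfolding M_def using x_norm
    by (intro subspace_sum subspace_scale subspace_traceless_Herm2 quadratic_defect_traceless) auto
  have "re_trace_form M M = (\<Sum>i<s. w i * re_trace_form M (quadratic_defect h (x i)))"
    by (subst (2) M_def)
      (simp add: linear_sum[OF linear_re_trace_form] linear_cmul[OF linear_re_trace_form])
  then have "M = 0"
    using first[OF M] M by (intro re_trace_form_eq_0_imp) (auto simp: traceless_Herm2_def)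
  moreover have "(\<Sum>i<s. w i * re_trace_form B (quadratic_defect h (x i)) * re_trace_form C (quadratic_defect h (x i)))
      = 1 / (2 * (real DIM('a) + 1)) * re_trace_form B C"
    if B: "B \<in> traceless_Herm2 D" and C: "C \<in> traceless_Herm2 D" for B C
  proof -
    have BC: "B \<in> Herm2 D" "C \<in> Herm2 D" "trace B = 0"
      using B C by (simp_all add: traceless_Herm2_def)
    have "homogeneous_poly 4 (\<lambda>v. gram_quadratic h B v * gram_quadratic h C v)"
      using homogeneous_poly_mult[OF gram_quadratic_homogeneous[OF BC(1)] gram_quadratic_homogeneous[OF BC(2)]]
      by simp
    then have "measure_pmf.expectation \<mu> (\<lambda>v. gram_quadratic h B v * gram_quadratic h C v)
        = (\<integral>v. gram_quadratic h B v * gram_quadratic h C v \<partial>spherical_measure)"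
      by (rule hom) simp_all
    moreover have "invariant_fun G \<rho> (\<lambda>v. gram_quadratic h B v * gram_quadratic h C v)"
      using gram_quadratic_invariant[of B] gram_quadratic_invariant[of C] by (simp add: invariant_fun_def)
    ultimately have "(\<Sum>i<s. w i * (gram_quadratic h B (x i) * gram_quadratic h C (x i)))
        = 2 * re_trace_form B C / (4 * (real DIM('a) + 1))"
      using spherical_moment_gram[OF BC(1,2)] BC(3) by (simp add: expectation_mu_invariant)
    also have "\<dots> = 1 / (2 * (real DIM('a) + 1)) * re_trace_form B C"
      by (simp add: divide_simps)
    finally show ?thesis
      by (simp add: gram_quadratic_traceless[OF B] gram_quadratic_traceless[OF C] mult.assoc)
  qed
  ultimately show ?thesis
    by (simp add: defect_equations_def M_def)
qed

lemma quartic_moment: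
  assumes quot: "quartic_quotient G \<rho> D h = {gram_quartics D h}"
    and eqs: "defect_equations D h s w x" and f: "homogeneous_poly 4 f"
  shows "measure_pmf.expectation \<mu> f = (\<integral>v. f v \<partial>spherical_measure)"
proof -
  have "group_average f \<in> invariant_quartics G \<rho>"
    using homogeneous_poly_group_average[OF f] group_average_invariant by (simp add: invariant_quartics_def)
  then have "group_average f \<in> gram_quartics D h"
    by (rule gram_quartics_of_quotient[OF quot])
  then obtain m :: nat and c B C where BC: "\<And>k. k < m \<Longrightarrow> B k \<in> Herm2 D \<and> C k \<in> Herm2 D"
    and avg: "group_average f = (\<lambda>x. \<Sum>k<m. c k * (gram_quadratic h (B k) x * gram_quadratic h (C k) x))"
    unfolding gram_quartics_def by blast
  have int: "integrable spherical_measure (\<lambda>x. gram_quadratic h (B k) x * gram_quadratic h (C k) x)"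
    if "k < m" for k
    using BC[OF that]
    by (intro integrable_spherical_continuous continuous_on_mult homogeneous_poly_continuous[OF gram_quadratic_homogeneous]) auto
  have "measure_pmf.expectation \<mu> f
      = (\<Sum>k<m. c k * (\<Sum>i<s. w i * (gram_quadratic h (B k) (x i) * gram_quadratic h (C k) (x i))))"
    unfolding expectation_mu avg sum_distrib_left by (subst sum.swap) (simp add: mult.left_commute)
  also have "\<dots> = (\<Sum>k<m. c k * (\<integral>v. gram_quadratic h (B k) v * gram_quadratic h (C k) v \<partial>spherical_measure))"
    using BC by (simp add: defect_equations_gram_moment[OF eqs x_norm w_sum])
  also have "\<dots> = (\<integral>v. group_average f v \<partial>spherical_measure)"
    unfolding avg using int by (simp add: Bochner_Integration.integral_sum)
  also have "\<dots> = (\<integral>v. f v \<partial>spherical_measure)"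
    by (rule integral_spherical_group_average[OF homogeneous_poly_continuous[OF f]])
  finally show ?thesis .
qed

text \<open>Both measures live on the sphere, so multiplying by a power of |v|^2 reduces degrees 0
  and 2 to the quartic case.\<close>

lemma even_moment:
  assumes quot: "quartic_quotient G \<rho> D h = {gram_quartics D h}"
    and eqs: "defect_equations D h s w x" and f: "homogeneous_poly k f" and k: "even k" "k \<le> 4"
  shows "measure_pmf.expectation \<mu> f = (\<integral>v. f v \<partial>spherical_measure)"
proof -
  define j where "j = (4 - k) div 2"
  have "2 * j + k = 4" using k by (auto simp: j_def)
  then have hom: "homogeneous_poly 4 (\<lambda>v. (v \<bullet> v) ^ j * f v)"
    using homogeneous_poly_raise[OF f, of j] by simp
  have "measure_pmf.expectation \<mu> f = measure_pmf.expectation \<mu> (\<lambda>v. (v \<bullet> v) ^ j * f v)"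
    by (rule expectation_mu_cong) (simp add: norm_eq_1)
  also have "\<dots> = (\<integral>v. (v \<bullet> v) ^ j * f v \<partial>spherical_measure)"
    by (rule quartic_moment[OF quot eqs hom])
  also have "\<dots> = (\<integral>v. f v \<partial>spherical_measure)"
    using hom f by (intro integral_spherical_cong homogeneous_poly_continuous) (auto simp: norm_eq_1)
  finally show ?thesis .
qed

text \<open>Multiplication by |v|^2 lifts degree 1 to degree 3, so vanishing cubic moments control
  the linear ones as well.\<close>

lemma odd_moment:
  assumes cub: "vanishing_cubic_moments \<mu>" and f: "homogeneous_poly k f" and k: "odd k" "k \<le> 3"
  shows "measure_pmf.expectation \<mu> f = 0"
proof -
  define j where "j = (3 - k) div 2"
  have "2 * j + k = 3" using k by (auto simp: j_def elim!: oddE)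
  then have "homogeneous_poly 3 (\<lambda>v. (v \<bullet> v) ^ j * f v)"
    using homogeneous_poly_raise[OF f, of j] by simp
  then have "measure_pmf.expectation \<mu> (\<lambda>v. (v \<bullet> v) ^ j * f v) = 0"
    using cub by (simp add: vanishing_cubic_moments_def)
  moreover have "measure_pmf.expectation \<mu> f = measure_pmf.expectation \<mu> (\<lambda>v. (v \<bullet> v) ^ j * f v)"
    by (rule expectation_mu_cong) (simp add: norm_eq_1)
  ultimately show ?thesis by simp
qed

lemma vanishing_cubic_moments_if_antipodal:
  assumes "antipodal \<mu>"
  shows "vanishing_cubic_moments \<mu>"
  unfolding vanishing_cubic_moments_def
proof (intro allI impI)
  fix f :: "'a ^ 2 \<Rightarrow> real" assume f: "homogeneous_poly 3 f"
  have "measure_pmf.expectation \<mu> f = measure_pmf.expectation (map_pmf uminus \<mu>) f"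
    using assms by (simp add: antipodal_def del: integral_map_pmf)
  also have "\<dots> = - measure_pmf.expectation \<mu> f"
    using expectation_mu_uminus[OF f] by simp
  finally show "measure_pmf.expectation \<mu> f = 0" by simp
qed

lemma vanishing_cubic_moments_if_no_harmonic:
  assumes irr: "irreducible_module G \<rho>" and nontriv: "nontrivial_module G \<rho>"
    and none: "\<And>f. homogeneous_poly 3 f \<Longrightarrow> invariant_fun G \<rho> f \<Longrightarrow> harmonic_fun f \<Longrightarrow> f = (\<lambda>v. 0)"
  shows "vanishing_cubic_moments \<mu>"
  unfolding vanishing_cubic_moments_def
proof (intro allI impI)
  fix f :: "'a ^ 2 \<Rightarrow> real" assume "homogeneous_poly 3 f"
  then have hom: "homogeneous_poly 3 (group_average f)"
    by (rule homogeneous_poly_group_average)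
  have "invariant_fun G \<rho> (laplacian (group_average f))"
    using group_average_invariant[of f] laplacian_cubic_orthogonal[OF hom diag_orthogonal]
    by (simp add: invariant_fun_def)
  then have "harmonic_fun (group_average f)"
    using invariant_linear_functional_zero[OF irr nontriv linear_laplacian_cubic[OF hom]]
    by (simp add: harmonic_fun_def)
  then have "group_average f = (\<lambda>v. 0)"
    by (rule none[OF hom group_average_invariant])
  then show "measure_pmf.expectation \<mu> f = 0"
    by (simp add: expectation_mu)
qed

end

section \<open>From homogeneous moments to the equivalence and the designs\<close>

theorem theorem4p2:
  fixes G :: "('g, 'r) monoid_scheme"
    and \<rho> :: "'g \<Rightarrow> 'a::euclidean_space \<Rightarrow> 'a"
    and D :: "quat set"
    and act :: "'a \<Rightarrow> quat \<Rightarrow> 'a"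
    and h :: "'a \<Rightarrow> 'a \<Rightarrow> quat"
    and s :: nat
    and w :: "nat \<Rightarrow> real"
    and x :: "nat \<Rightarrow> 'a ^ 2"
    and \<mu> :: "('a ^ 2) pmf"
  assumes "finite (carrier G)"
    and "orthogonal_module G \<rho>"
    and "irreducible_module G \<rho>"
    and "nontrivial_module G \<rho>"
    and "endo_scalars G \<rho> D act"
    and "invariant_hermitian_form G \<rho> D act h"
    and "quartic_quotient G \<rho> D h = {gram_quartics D h}"
    and "\<forall>i<s. x i \<in> sphere 0 1"
    and "\<forall>i<s. w i > 0"
    and "(\<Sum>i<s. w i) = 1"
    and "\<mu> = orbit_mixture G \<rho> s w x"
  shows
    "((\<forall>f. poly_degree_le 4 f \<and> (\<forall>v. f (- v) = f v) \<longrightarrow>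
          measure_pmf.expectation \<mu> f = (\<integral>v. f v \<partial>spherical_measure))
        \<longleftrightarrow> defect_equations D h s w x)
     \<and> (defect_equations D h s w x \<longrightarrow> weighted_spherical_design 4 (antipodalization \<mu>))
     \<and> (defect_equations D h s w x \<and> vanishing_cubic_moments \<mu> \<longrightarrow> weighted_spherical_design 4 \<mu>)
     \<and> (antipodal \<mu> \<longrightarrow> vanishing_cubic_moments \<mu>)
     \<and> ((\<forall>f. homogeneous_poly 3 f \<and> invariant_fun G \<rho> f \<and> harmonic_fun f \<longrightarrow> f = (\<lambda>v. 0))
          \<longrightarrow> vanishing_cubic_moments \<mu>)"
proof -
  interpret orbit_design G \<rho> D act h s w x \<mu>
    by unfold_locales (use assms in auto)
  note even = even_moment[OF assms(7)]
  show ?thesis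
  proof (intro conjI impI iffI)
    assume "\<forall>f. poly_degree_le 4 f \<and> (\<forall>v. f (- v) = f v) \<longrightarrow>
          measure_pmf.expectation \<mu> f = (\<integral>v. f v \<partial>spherical_measure)"
    then show "defect_equations D h s w x"
      by (intro defect_equations_if_even_moments) blast
  next
    assume eqs: "defect_equations D h s w x"
    show "\<forall>f. poly_degree_le 4 f \<and> (\<forall>v. f (- v) = f v) \<longrightarrow>
          measure_pmf.expectation \<mu> f = (\<integral>v. f v \<partial>spherical_measure)"
    proof (intro allI impI, elim conjE)
      fix f :: "'a ^ 2 \<Rightarrow> real" assume "poly_degree_le 4 f" "\<forall>v. f (- v) = f v"
      then obtain p where p: "\<And>k. k \<le> 4 \<Longrightarrow> homogeneous_poly k (p k)"
        "\<And>k. odd k \<Longrightarrow> p k = (\<lambda>x. 0)" and f: "f = (\<lambda>x. \<Sum>k\<le>4. p k x)"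
        using poly_degree_le_even by metis
      \<comment> \<open>For odd k the component is the zero function, so both sides are 0.\<close>
      have "measure_pmf.expectation \<mu> (p k) = (\<integral>v. p k v \<partial>spherical_measure)" if "k \<le> 4" for k
        using even[OF eqs p(1)[OF that] _ that] p(2)[of k] by (cases "even k") auto
      then show "measure_pmf.expectation \<mu> f = (\<integral>v. f v \<partial>spherical_measure)"
        unfolding f using p finite_mu by (intro expectation_polynomial) auto
    qed
  next
    assume eqs: "defect_equations D h s w x"
    note anti = antipodalization_finite[OF finite_mu]
    show "weighted_spherical_design 4 (antipodalization \<mu>)"
    proof (rule weighted_spherical_designI)
      show "finite (set_pmf (antipodalization \<mu>))"
        using anti(1) by (rule finite_subset) (simp add: finite_mu)
      show "set_pmf (antipodalization \<mu>) \<subseteq> sphere 0 1"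
        using anti(1) mu_sphere by fastforce
      fix k :: nat and p :: "'a ^ 2 \<Rightarrow> real"
      assume k: "k \<le> 4" and p: "homogeneous_poly k p"
      \<comment> \<open>The factor (1 + (-1)^k) / 2 keeps even moments and removes odd ones, in
        agreement with \<open>integral_spherical_odd\<close>.\<close>
      have E: "measure_pmf.expectation (antipodalization \<mu>) p
          = (measure_pmf.expectation \<mu> p + (- 1) ^ k * measure_pmf.expectation \<mu> p) / 2"
        by (simp add: anti(2) expectation_mu_uminus[OF p])
      show "measure_pmf.expectation (antipodalization \<mu>) p = (\<integral>v. p v \<partial>spherical_measure)"
        using even[OF eqs p _ k] integral_spherical_odd[OF p] by (cases "even k") (simp_all add: E)
    qed
  next
    assume *: "defect_equations D h s w x \<and> vanishing_cubic_moments \<mu>"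
    show "weighted_spherical_design 4 \<mu>"
    proof (rule weighted_spherical_designI[OF finite_mu mu_sphere])
      fix k :: nat and p :: "'a ^ 2 \<Rightarrow> real"
      assume k: "k \<le> 4" and p: "homogeneous_poly k p"
      show "measure_pmf.expectation \<mu> p = (\<integral>v. p v \<partial>spherical_measure)"
      proof (cases "even k")
        case True
        then show ?thesis using even[OF _ p _ k] * by simp
      next
        case False
        \<comment> \<open>An odd degree at most 4 is at most 3, the range of
          \<open>odd_moment\<close>.\<close>
        then have "k \<le> 3" using k by (cases "k = 4") auto
        then show ?thesis
          using odd_moment[OF _ p False] integral_spherical_odd[OF p False] * by simp
      qed
    qed
  next
    assume "antipodal \<mu>"
    then show "vanishing_cubic_moments \<mu>"
      by (rule vanishing_cubic_moments_if_antipodal)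
  next
    assume "\<forall>f. homogeneous_poly 3 f \<and> invariant_fun G \<rho> f \<and> harmonic_fun f \<longrightarrow> f = (\<lambda>v. 0)"
    then show "vanishing_cubic_moments \<mu>"
      using assms(3,4) by (intro vanishing_cubic_moments_if_no_harmonic) auto
  qed
qed

end
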